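(* Let $q\ge2$ and $r\ge0$ be integers and let $f$ be a $q$-quasimultiplicative function with parameter $r$ (i.e. $f(q^{k+r}a+b)=f(a)f(b)$ for all nonnegative integers $a,b,k$ with $0\le b<q^k$) taking only positive values, and assume $f$ has at most polynomial growth, i.e. there is a constant $c\ge0$ with $f(n)=O(n^c)$ and $f(n)=\Omega(n^{-c})$. Let $\mathcal{B}$ be the set of all positive integers not divisible by $q$ whose $q$-ary representation does not contain the block $0^r$ ($r$ consecutive zeros), let $\ell(n)$ be the length of the $q$-ary representation of $n$, and let $B(x,t)=\sum_{n\in\mathcal{B}}x^{\ell(n)}f(n)^t$. Let $N_k$ be a uniformly random integer in $\{0,1,\dots,q^k-1\}$ and $L_k=\log f(N_k)$. Then $L_k$ has mean $\mu k+O(1)$ and variance $\sigma^2k+O(1)$, where, writing $B_t,B_{tt},B_{tx}$ for partial derivatives of $B$ all evaluated at $(x,t)=(1/q,0)$, $$\mu=\frac{B_t}{q^{2r}}$$ and $$\sigma^2=-B_t^2q^{-4r+1}(q-1)^{-1}+2B_t^2q^{-3r+1}(q-1)^{-1}-B_t^2q^{-4r}(q-1)^{-1}-4rB_t^2q^{-4r}+B_{tt}q^{-2r}-2B_tB_{tx}q^{-4r-1}.$$ If $f$ is not the constant function $f\equiv1$, then $\sigma^2\ne0$ and $(L_k-\mu k)/(\sigma\sqrt k)$ converges weakly to a standard Gaussian distribution.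
   Formalization: For r=0 the set B is taken to be {1,…,q−1} (only occurrences of 0^r with digits on both sides count); read literally, the empty block occurs in every word, so B is empty and the claim fails, e.g. for f(n)=2^(digit sum of n). For r≥1 the set B is unchanged. *)

theory Defs
  imports "HOL-Probability.Probability" "HOL-Library.Log_Nat" "HOL-Library.Landau_Symbols"
    "HOL-Library.Sublist"
begin

definition quasimultiplicative :: "nat \<Rightarrow> nat \<Rightarrow> (nat \<Rightarrow> real) \<Rightarrow> bool" where
  "quasimultiplicative q r f \<longleftrightarrow>
     (\<forall>a b k. b < q ^ k \<longrightarrow> f (q ^ (k + r) * a + b) = f a * f b)"

definition poly_growth :: "(nat \<Rightarrow> real) \<Rightarrow> bool" where
  "poly_growth f \<longleftrightarrow>
     (\<exists>c\<ge>0. f \<in> O(\<lambda>n. real n powr c) \<and> f \<in> \<Omega>(\<lambda>n. real n powr (- c)))"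

text \<open>The length of the \<open>q\<close>-ary representation of \<open>n\<close> is \<^term>\<open>floorlog q n\<close>
  (with length \<open>0\<close> for \<open>n = 0\<close>). The most significant digit comes first.\<close>

definition qary_digits :: "nat \<Rightarrow> nat \<Rightarrow> nat list" where
  "qary_digits q n = map (\<lambda>i. n div q ^ i mod q) (rev [0..<floorlog q n])"

text \<open>An occurrence of the block \<open>0\<^sup>r\<close> is required to be interior, i.e. to have at least one
  digit on either side. For \<open>r \<ge> 1\<close> and \<open>n\<close> not divisible by \<open>q\<close> this is no restriction, since
  both the first and the last digit are nonzero (lemma \<open>block_set_eq_sublist\<close>). It only
  matters for \<open>r = 0\<close>: the empty block is a factor of every word, so without this
  convention \<open>block_set q 0\<close> would be empty, whereas the pieces into which the functional
  equation with \<open>r = 0\<close> decomposes a number are its single nonzero digits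
  (lemma \<open>block_set_0\<close>).\<close>

definition contains_zero_block :: "nat \<Rightarrow> nat list \<Rightarrow> bool" where
  "contains_zero_block r w \<longleftrightarrow> (\<exists>u v. u \<noteq> [] \<and> v \<noteq> [] \<and> w = u @ replicate r 0 @ v)"

definition block_set :: "nat \<Rightarrow> nat \<Rightarrow> nat set" where
  "block_set q r = {n. n > 0 \<and> \<not> q dvd n \<and> \<not> contains_zero_block r (qary_digits q n)}"

definition BB :: "nat \<Rightarrow> nat \<Rightarrow> (nat \<Rightarrow> real) \<Rightarrow> real \<Rightarrow> real \<Rightarrow> real" where
  "BB q r f x t = (\<Sum>\<^sub>\<infinity>n\<in>block_set q r. x ^ floorlog q n * f n powr t)"

definition B_t :: "nat \<Rightarrow> nat \<Rightarrow> (nat \<Rightarrow> real) \<Rightarrow> real" where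
  "B_t q r f = deriv (\<lambda>t. BB q r f (1 / real q) t) 0"

definition B_tt :: "nat \<Rightarrow> nat \<Rightarrow> (nat \<Rightarrow> real) \<Rightarrow> real" where
  "B_tt q r f = deriv (\<lambda>s. deriv (\<lambda>t. BB q r f (1 / real q) t) s) 0"

definition B_tx :: "nat \<Rightarrow> nat \<Rightarrow> (nat \<Rightarrow> real) \<Rightarrow> real" where
  "B_tx q r f = deriv (\<lambda>x. deriv (\<lambda>t. BB q r f x t) 0) (1 / real q)"

definition mean_const :: "nat \<Rightarrow> nat \<Rightarrow> (nat \<Rightarrow> real) \<Rightarrow> real" where
  "mean_const q r f = B_t q r f / real q ^ (2 * r)"

definition var_const :: "nat \<Rightarrow> nat \<Rightarrow> (nat \<Rightarrow> real) \<Rightarrow> real" where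
  "var_const q r f =
     - (B_t q r f)\<^sup>2 * real q powi (- 4 * int r + 1) * (real q - 1) powi (- 1)
     + 2 * (B_t q r f)\<^sup>2 * real q powi (- 3 * int r + 1) * (real q - 1) powi (- 1)
     - (B_t q r f)\<^sup>2 * real q powi (- 4 * int r) * (real q - 1) powi (- 1)
     - 4 * real r * (B_t q r f)\<^sup>2 * real q powi (- 4 * int r)
     + B_tt q r f * real q powi (- 2 * int r)
     - 2 * B_t q r f * B_tx q r f * real q powi (- 4 * int r - 1)"

definition unif_pmf :: "nat \<Rightarrow> nat \<Rightarrow> nat pmf" where
  "unif_pmf q k = pmf_of_set {0..<q ^ k}"

lemma qary_digits_props:
  assumes "q \<ge> 2" "n > 0"
  shows "qary_digits q n \<noteq> []" "last (qary_digits q n) = n mod q"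
    "hd (qary_digits q n) \<noteq> 0"
proof -
  define m where "m = floorlog q n"
  have b: "q ^ (m - 1) \<le> n" "n < q ^ m"
    using floorlog_bounds[of n q] assms unfolding m_def by auto
  have m: "m > 0" using b assms by (cases m) auto
  have e: "[0..<m] = 0 # [1..<m]" using m by (simp add: upt_conv_Cons)
  have e2: "[0..<m] = [0..<m - 1] @ [m - 1]" using m upt_Suc_append[of 0 "m - 1"] by simp
  show "qary_digits q n \<noteq> []" using m by (simp add: qary_digits_def flip: m_def)
  show "last (qary_digits q n) = n mod q"
    by (simp add: qary_digits_def e flip: m_def)
  have "hd (qary_digits q n) = n div q ^ (m - 1) mod q"
    by (simp add: qary_digits_def e2 flip: m_def)
  moreover have "n div q ^ (m - 1) < q"
    using b m assms by (simp add: less_mult_imp_div_less flip: power_Suc)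
  moreover have "n div q ^ (m - 1) > 0" using b assms by (simp add: div_greater_zero_iff)
  ultimately show "hd (qary_digits q n) \<noteq> 0" by simp
qed

lemma block_set_eq_sublist:
  assumes "q \<ge> 2" "r \<ge> 1"
  shows "block_set q r = {n. n > 0 \<and> \<not> q dvd n \<and> \<not> sublist (replicate r 0) (qary_digits q n)}"
proof -
  have "contains_zero_block r (qary_digits q n) \<longleftrightarrow> sublist (replicate r 0) (qary_digits q n)"
    if n: "n > 0" "\<not> q dvd n" for n
  proof
    assume "contains_zero_block r (qary_digits q n)"
    then show "sublist (replicate r 0) (qary_digits q n)"
      by (auto simp: contains_zero_block_def sublist_def)
  next
    assume "sublist (replicate r 0) (qary_digits q n)"
    then obtain u v where uv: "qary_digits q n = u @ replicate r 0 @ v"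
      by (auto simp: sublist_def)
    have "last (qary_digits q n) \<noteq> 0" "hd (qary_digits q n) \<noteq> 0"
      using qary_digits_props[of q n] assms n by (auto simp: mod_eq_0_iff_dvd)
    then have "u \<noteq> []" "v \<noteq> []" using assms(2) unfolding uv
      by (auto simp: hd_append last_append)
    then show "contains_zero_block r (qary_digits q n)"
      using uv by (auto simp: contains_zero_block_def)
  qed
  then show ?thesis by (auto simp: block_set_def)
qed

lemma block_set_0:
  assumes "q \<ge> 2"
  shows "block_set q 0 = {1..<q}"
proof -
  have c: "contains_zero_block 0 w \<longleftrightarrow> length w \<ge> 2" for w
  proof
    assume "length w \<ge> 2"
    then obtain a b w' where "w = a # b # w'" by (cases w; cases "tl w") auto
    then have "w = [a] @ replicate 0 0 @ (b # w')" by simp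
    then show "contains_zero_block 0 w" unfolding contains_zero_block_def by blast
  next
    assume "contains_zero_block 0 w"
    then obtain u v where "u \<noteq> []" "v \<noteq> []" "w = u @ v"
      by (auto simp: contains_zero_block_def)
    then show "length w \<ge> 2" by (cases u; cases v) auto
  qed
  have "length (qary_digits q n) \<ge> 2 \<longleftrightarrow> n \<ge> q" if n: "n > 0" for n
  proof -
    have b: "q ^ (floorlog q n - 1) \<le> n" "n < q ^ floorlog q n"
      using floorlog_bounds[of n q] assms n by auto
    have "n < q" if "floorlog q n < 2"
      using b(2) n that assms by (cases "floorlog q n") auto
    moreover have "q \<le> n" if l: "floorlog q n \<ge> 2"
    proof -
      have "1 \<le> floorlog q n - 1" using l by linarith
      then have "q ^ 1 \<le> q ^ (floorlog q n - 1)" using assms by (intro power_increasing) auto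
      then show ?thesis using b(1) by simp
    qed
    ultimately show ?thesis unfolding qary_digits_def length_map length_rev length_upt by linarith
  qed
  then show ?thesis using assms by (auto simp: block_set_def c dest: dvd_imp_le)
qed

end

(* Read from its least significant end, a number is a concatenation of cycles: a single digit 0, or
   a block of B preceded by r zeros. Along this decomposition log f is additive, so for a uniformly
   random number it is a renewal-reward process: the cycles are independent, one of length j
   containing the block b has probability q^(-j) and reward log f(b), and a renewal occurs at time k
   exactly when the last r digits (or, for k < r, all digits) are zero, i.e. with probability
   q^(-min(k,r)). Prefixing or appending r zeros does not change f, so averages over all words of
   length k are averages over the renewal words of length k + r, up to the factor q^r.

   Let Y be the reward of a cycle minus mu times its length. The constant mu is the one for which
   Y has mean 0, and sigma^2 = q^(-r) E Y^2, which vanishes only if all rewards vanish. Since the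
   renewal probabilities are explicit, the renewal equations for the first two moments can be solved
   by power series, with bounded error. The characteristic function x_k of the centred sum satisfies
   x_k - x_{k-1} = sum_j e_j(s) x_{k-j}, where e_j(s) = O(s) decays exponentially in j and
   sum_j e_j(s) = - sigma^2 s^2 / 2 + O(s^3). Hence x_k is close to exp(- sigma^2 s^2 k / 2) for
   s of order k^(-1/2), and Levy's continuity theorem applies. *)

theory Submission
  imports Defs
begin

section \<open>Decomposition of numbers into cycles\<close>

text \<open>The renewal probabilities \<open>u k\<close> are constant from \<open>k = r\<close> on,
  so multiplying their generating function by \<open>1 - fps_X\<close> leaves a polynomial
  \<open>V\<close> of degree at most r with V(1) = q^(-r), and
  \<open>V * (1 - P) = 1 - fps_X\<close>, where \<open>P\<close> generates the cycle lengths. This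
  identity is used twice. Differentiated at 1, it gives the first two moments of the cycle length
  and with them the closed form of sigma^2. Applied to characteristic functions, it cancels the
  unperturbed part of the renewal equation, whose kernel has mass 1 and gives no smallness, and
  leaves an equation for the increments driven by a kernel of order s. The remaining obstacle is
  that an increment depends on the whole past. Replacing x_{k-j} by x_{k-1} costs the increments in
  between, which are small themselves: the total variation of the sequence is bounded by at most
  half of itself plus explicit terms. The recursion starts at index r, where the value is known
  exactly: the only renewal word of length r is the zero word, of weight q^(-r), and this weight is
  what the normalisation by q^r removes.\<close>

lemma mod_power_Suc_eq_0_iff:
  fixes m q :: nat
  assumes "q > 0"
  shows "m mod q ^ Suc r = 0 \<longleftrightarrow> m mod q ^ r = 0 \<and> m div q ^ r mod q = 0"
  using mod_mult2_eq[of m "q ^ r" q] assms by (auto simp: mult.commute)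

lemma mod_power_eq_0_iff_digits:
  fixes m q :: nat
  assumes "q > 0"
  shows "m mod q ^ r = 0 \<longleftrightarrow> (\<forall>j<r. m div q ^ j mod q = 0)"
proof (induction r)
  case (Suc r)
  show ?case using Suc mod_power_Suc_eq_0_iff[OF assms, of m r]
    by (auto simp: less_Suc_eq)
qed auto

text \<open>Position \<open>p\<close> in the digit list belongs to the exponent
  \<open>L - 1 - p\<close>, and \<open>i\<close> is the length of the suffix \<open>v\<close> below
  the zeros. Hence \<open>i \<ge> 1\<close> and \<open>i + r < L\<close> express that
  \<open>v\<close> and \<open>u\<close> are nonempty.\<close>

lemma contains_zero_block_qary_iff:
  assumes "q \<ge> 2"
  shows "contains_zero_block r (qary_digits q n) \<longleftrightarrow>
    (\<exists>i\<ge>1. i + r < floorlog q n \<and> (n div q ^ i) mod q ^ r = 0)"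
proof -
  define L where "L = floorlog q n"
  define w where "w = qary_digits q n"
  have len: "length w = L" by (simp add: w_def qary_digits_def L_def)
  have nth: "w ! p = n div q ^ (L - 1 - p) mod q" if "p < L" for p
    using that by (simp add: w_def qary_digits_def rev_nth flip: L_def)
  have z: "(n div q ^ i) mod q ^ r = 0 \<longleftrightarrow> (\<forall>j<r. n div q ^ (i + j) mod q = 0)" for i
    using mod_power_eq_0_iff_digits[of q "n div q ^ i" r] assms
    by (simp add: div_mult2_eq power_add)
  show ?thesis unfolding w_def[symmetric] L_def[symmetric]
  proof
    assume "contains_zero_block r w"
    then obtain u v where uv: "u \<noteq> []" "v \<noteq> []" "w = u @ replicate r 0 @ v"
      by (auto simp: contains_zero_block_def)
    have l: "L = length u + r + length v" using len uv by simp
    have "n div q ^ (length v + j) mod q = 0" if "j < r" for j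
    proof -
      define p where "p = length u + (r - 1 - j)"
      have "w ! p = 0" using that uv(3) by (simp add: p_def nth_append)
      moreover have "p < L" "L - 1 - p = length v + j" using that l uv by (auto simp: p_def)
      ultimately show ?thesis using nth[of p] by simp
    qed
    then show "\<exists>i\<ge>1. i + r < L \<and> (n div q ^ i) mod q ^ r = 0"
      using l uv by (intro exI[of _ "length v"]) (auto simp: z Suc_le_eq)
  next
    assume "\<exists>i\<ge>1. i + r < L \<and> (n div q ^ i) mod q ^ r = 0"
    then obtain i where i: "i \<ge> 1" "i + r < L" "\<And>j. j < r \<Longrightarrow> n div q ^ (i + j) mod q = 0"
      by (auto simp: z)
    have "take r (drop (L - i - r) w) = replicate r 0"
    proof (rule nth_equalityI)
      fix p assume "p < length (take r (drop (L - i - r) w))"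
      then have p: "p < r" by simp
      then have "take r (drop (L - i - r) w) ! p = w ! (L - i - r + p)"
        using i len by simp
      also have "\<dots> = n div q ^ (i + (r - 1 - p)) mod q"
        using i p nth[of "L - i - r + p"] by (simp add: algebra_simps)
      also have "\<dots> = 0" using i(3)[of "r - 1 - p"] p by simp
      finally show "take r (drop (L - i - r) w) ! p = replicate r 0 ! p" using p by simp
    qed (use i len in auto)
    then have "w = take (L - i - r) w @ replicate r 0 @ drop r (drop (L - i - r) w)"
      by (metis append_take_drop_id)
    moreover have "take (L - i - r) w \<noteq> []" "drop r (drop (L - i - r) w) \<noteq> []"
      using i len by auto
    ultimately show "contains_zero_block r w" unfolding contains_zero_block_def by blast
  qed
qed

lemma floorlog_eqI:
  fixes n q l :: nat
  assumes "q \<ge> 2" "q ^ l \<le> n" "n < q ^ Suc l"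
  shows "floorlog q n = Suc l"
  using floorlog_leI[of n q "Suc l"] floorlog_ge_SucI[of q l n] assms by simp

lemma floorlog_lower:
  fixes n q :: nat
  assumes "q \<ge> 2" "n > 0"
  shows "q ^ (floorlog q n - 1) \<le> n"
  using floorlog_bounds[of n q] assms by auto

lemma floorlog_upper:
  fixes n q :: nat
  assumes "q \<ge> 2"
  shows "n < q ^ floorlog q n"
proof (cases "n = 0")
  case False
  then show ?thesis using floorlog_bounds[of n q] assms by auto
qed (use assms in auto)

lemma floorlog_pos:
  fixes n q :: nat
  assumes "q \<ge> 2" "n > 0"
  shows "floorlog q n > 0"
  using floorlog_upper[OF assms(1), of n] assms by (cases "floorlog q n") auto

text \<open>The upper bound on the window may be relaxed from \<open>i + r < floorlog q n\<close> to
  \<open>i < floorlog q n\<close>: a window reaching the leading digit has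
  \<open>n div q ^ i < q ^ r\<close>, so a zero residue would make this quotient 0 and
  \<open>n\<close> too short.\<close>

lemma block_set_iff:
  assumes "q \<ge> 2"
  shows "n \<in> block_set q r \<longleftrightarrow>
    \<not> q dvd n \<and> (\<forall>i. 1 \<le> i \<and> i < floorlog q n \<longrightarrow> (n div q ^ i) mod q ^ r \<noteq> 0)"
proof -
  have eq: "(\<exists>i\<ge>1. i + r < floorlog q n \<and> (n div q ^ i) mod q ^ r = 0) \<longleftrightarrow>
        (\<exists>i\<ge>1. i < floorlog q n \<and> (n div q ^ i) mod q ^ r = 0)" if n: "n > 0"
  proof
    assume "\<exists>i\<ge>1. i < floorlog q n \<and> (n div q ^ i) mod q ^ r = 0"
    then obtain i where i: "i \<ge> 1" "i < floorlog q n" "(n div q ^ i) mod q ^ r = 0" by auto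
    have "i + r < floorlog q n"
    proof (rule ccontr)
      assume "\<not> i + r < floorlog q n"
      then have "q ^ floorlog q n \<le> q ^ (i + r)" using assms by (intro power_increasing) auto
      then have "n < q ^ i * q ^ r" using floorlog_upper[OF assms, of n] by (simp add: power_add)
      then have "n div q ^ i < q ^ r" by (simp add: less_mult_imp_div_less mult.commute)
      then have "n div q ^ i = 0" using i by simp
      then have "n < q ^ i" using assms by (simp add: div_eq_0_iff)
      also have "q ^ i \<le> q ^ (floorlog q n - 1)" using assms i by (intro power_increasing) auto
      also have "\<dots> \<le> n" using floorlog_lower[OF assms n] .
      finally show False by simp
    qed
    then show "\<exists>i\<ge>1. i + r < floorlog q n \<and> (n div q ^ i) mod q ^ r = 0"
      by (intro exI[of _ i] conjI i(1,3))
  next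
    assume "\<exists>i\<ge>1. i + r < floorlog q n \<and> (n div q ^ i) mod q ^ r = 0"
    then obtain i where i: "i \<ge> 1" "i + r < floorlog q n" "(n div q ^ i) mod q ^ r = 0" by auto
    then have "i < floorlog q n" by linarith
    then show "\<exists>i\<ge>1. i < floorlog q n \<and> (n div q ^ i) mod q ^ r = 0"
      by (intro exI[of _ i] conjI i(1,3))
  qed
  show ?thesis
  proof (cases "q dvd n")
    case False
    then have n: "n > 0" by (rule_tac ccontr) auto
    show ?thesis
      unfolding block_set_def contains_zero_block_qary_iff[OF assms] mem_Collect_eq eq[OF n]
      using n by metis
  qed (simp add: block_set_def)
qed

text \<open>A number is read from its least significant end as a sequence of cycles: a single digit
  zero, or a block of \<open>block_set\<close> preceded by \<open>r\<close> zeros. For a uniformly random number the cycles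
  are those of a renewal process with i.i.d. increments of law \<open>card (cycles q r j) / q ^ j\<close>.\<close>

definition cycles :: "nat \<Rightarrow> nat \<Rightarrow> nat \<Rightarrow> nat set" where
  "cycles q r j = {b \<in> block_set q r. floorlog q b + r = j} \<union> (if j = 1 then {0} else {})"

lemma cycles_cases:
  assumes "b \<in> cycles q r j"
  obtains "b = 0" "j = 1" | "b \<in> block_set q r" "j = floorlog q b + r"
  using assms by (auto simp: cycles_def split: if_splits)

lemma cycles_pos:
  assumes "q \<ge> 2" "b \<in> cycles q r j"
  shows "j \<ge> 1"
  using assms(2)
proof (cases rule: cycles_cases)
  case 2
  then have "b > 0" by (simp add: block_set_def)
  then show ?thesis using 2 floorlog_pos[OF assms(1), of b] by simp
qed simp

lemma cycles_less:
  assumes "q \<ge> 2" "b \<in> cycles q r j"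
  shows "b < q ^ (j - r)"
  using assms(2)
proof (cases rule: cycles_cases)
  case 2
  then show ?thesis using floorlog_upper[OF assms(1), of b] by simp
qed (use assms in simp)

lemma cycles_less_power:
  assumes "q \<ge> 2" "b \<in> cycles q r j"
  shows "b < q ^ j"
proof -
  have "q ^ (j - r) \<le> q ^ j" using assms by (intro power_increasing) auto
  then show ?thesis using cycles_less[OF assms] by simp
qed

lemma finite_cycles: "q \<ge> 2 \<Longrightarrow> finite (cycles q r j)"
  by (rule finite_subset[of _ "{..<q ^ j}"]) (auto dest: cycles_less_power)

text \<open>A window of \<open>r\<close> digits starting at position at most \<open>l\<close> ends
  below position \<open>l + r\<close>, so it does not see \<open>a\<close>. This transfers the block
  condition between a number and its lowest cycle.\<close>

lemma block_appended_mod: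
  fixes q a b :: nat
  assumes "q \<ge> 2" "i \<le> l"
  shows "((q ^ (l + r) * a + b) div q ^ i) mod q ^ r = (b div q ^ i) mod q ^ r"
proof -
  obtain d where d: "l = i + d" using assms(2) by (auto simp: le_iff_add)
  have "q ^ (l + r) * a + b = b + q ^ i * (q ^ r * (q ^ d * a))"
    by (simp add: d power_add algebra_simps)
  then have "(q ^ (l + r) * a + b) div q ^ i = q ^ r * (q ^ d * a) + b div q ^ i"
    using assms by (metis div_mult_self2 add.commute not_numeral_le_zero power_not_zero)
  then show ?thesis by simp
qed

lemma cycle_exists:
  assumes "q \<ge> 2"
  shows "\<exists>j. n mod q ^ j \<in> cycles q r j"
proof (cases "q dvd n")
  case True
  then have "n mod q ^ 1 \<in> cycles q r 1" by (auto simp: cycles_def)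
  then show ?thesis by blast
next
  case False
  then have n: "n > 0" by (rule_tac ccontr) auto
  define Q where "Q i \<longleftrightarrow> 1 \<le> i \<and> (n div q ^ i) mod q ^ r = 0" for i
  \<comment> \<open>Position \<open>n\<close> lies beyond all digits of \<open>n\<close>, so a zero
    window starts there and a least such position \<open>l\<close> exists. The block will consist of
    the digits below \<open>l\<close>.\<close>
  have "n < q ^ n" using assms by (intro power_gt_expt) auto
  then have "Q n" using n by (simp add: Q_def)
  define l where "l = (LEAST i. Q i)"
  have Ql: "Q l" unfolding l_def using \<open>Q n\<close> by (rule LeastI)
  have nQ: "\<not> Q i" if "i < l" for i using that unfolding l_def by (rule not_less_Least)
  define b where "b = n mod q ^ l"
  define a where "a = n div q ^ (l + r)"
  have l1: "l \<ge> 1" using Ql by (simp add: Q_def)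
  have "n = q ^ l * (n div q ^ l) + b" by (simp add: b_def)
  also have "n div q ^ l = q ^ r * (n div q ^ l div q ^ r)"
    using Ql by (auto simp: Q_def)
  also have "n div q ^ l div q ^ r = a" by (simp add: a_def power_add div_mult2_eq)
  finally have eq: "n = q ^ (l + r) * a + b" by (simp add: power_add)
  have b_lt: "b < q ^ l" using assms by (simp add: b_def)
  have b0: "\<not> q dvd b"
  proof
    assume "q dvd b"
    moreover have "q dvd q ^ (l + r) * a" using l1 by (cases l) auto
    ultimately have "q dvd n" using eq by (metis dvd_add)
    then show False using False by simp
  qed
  \<comment> \<open>If the top digit of \<open>b\<close> were zero, a zero window would already
    start at \<open>l - 1\<close>, against minimality. Hence \<open>b\<close> has length exactly
    \<open>l\<close>.\<close>
  have "q ^ (l - 1) \<le> b"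
  proof (rule ccontr)
    assume "\<not> q ^ (l - 1) \<le> b"
    then have b': "b < q ^ (l - 1)" by simp
    then have "l - 1 \<ge> 1" using b0 by (cases "l - 1") auto
    moreover have "(n div q ^ (l - 1)) mod q ^ r = 0"
      using b' block_appended_mod[OF assms, of "l - 1" l r a b] eq by simp
    ultimately show False using nQ[of "l - 1"] l1 by (simp add: Q_def)
  qed
  then have fl: "floorlog q b = l" using floorlog_eqI[OF assms, of "l - 1" b] b_lt l1 by simp
  have "b \<in> block_set q r" unfolding block_set_iff[OF assms] fl
  proof (intro conjI allI impI)
    fix i assume i: "1 \<le> i \<and> i < l"
    then have "(n div q ^ i) mod q ^ r \<noteq> 0" using nQ[of i] by (simp add: Q_def)
    then show "(b div q ^ i) mod q ^ r \<noteq> 0"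
      using block_appended_mod[OF assms, of i l r a b] eq i by simp
  qed (use b0 in simp)
  then have "b \<in> cycles q r (l + r)" using fl by (simp add: cycles_def)
  moreover have "n mod q ^ (l + r) = b"
  proof -
    have "q ^ l \<le> q ^ (l + r)" using assms by (intro power_increasing) auto
    then have "b < q ^ (l + r)" using b_lt by linarith
    then show ?thesis by (simp add: eq)
  qed
  ultimately show ?thesis by metis
qed

text \<open>The number determines the length: 1 if its last digit is zero, and otherwise
  \<open>r\<close> plus the least positive position where \<open>r\<close> zeros begin, because the
  block contains no such position and is followed by one.\<close>

lemma cycle_unique:
  assumes "q \<ge> 2" "n mod q ^ j \<in> cycles q r j" "n mod q ^ j' \<in> cycles q r j'"
  shows "j = j'"
proof -
  have *: "q dvd n \<and> j = 1 \<or> \<not> q dvd n \<and> r \<le> j \<and> j = (LEAST i. 1 \<le> i \<and> (n div q ^ i) mod q ^ r = 0) + r"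
    if c: "n mod q ^ j \<in> cycles q r j" for j
    using c
  proof (cases rule: cycles_cases)
    case 1
    then show ?thesis by auto
  next
    case 2
    define b where "b = n mod q ^ j"
    define l where "l = floorlog q b"
    define a where "a = n div q ^ j"
    have eq: "n = q ^ (l + r) * a + b" using 2(2) by (simp add: a_def b_def l_def)
    have "b > 0" using 2 by (simp add: block_set_def b_def)
    then have l1: "l \<ge> 1" using floorlog_pos[OF assms(1), of b] by (simp add: l_def)
    have bl: "\<not> q dvd b" "\<And>i. 1 \<le> i \<Longrightarrow> i < l \<Longrightarrow> (b div q ^ i) mod q ^ r \<noteq> 0"
      using 2(1) block_set_iff[OF assms(1), of b r] by (auto simp: b_def l_def)
    have "q dvd q ^ (l + r) * a" using l1 by (cases l) auto
    then have nd: "\<not> q dvd n" using eq bl(1) by (metis dvd_add_right_iff)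
    have "(LEAST i. 1 \<le> i \<and> (n div q ^ i) mod q ^ r = 0) = l"
    proof (rule Least_equality)
      have "b < q ^ l" using floorlog_upper[OF assms(1), of b] by (simp add: l_def)
      then show "1 \<le> l \<and> (n div q ^ l) mod q ^ r = 0"
        using l1 block_appended_mod[OF assms(1), of l l r a b] eq by simp
      show "l \<le> i" if "1 \<le> i \<and> (n div q ^ i) mod q ^ r = 0" for i
      proof (rule ccontr)
        assume "\<not> l \<le> i"
        then show False
          using that bl(2)[of i] block_appended_mod[OF assms(1), of i l r a b] eq by simp
      qed
    qed
    then show ?thesis using nd 2(2) by (simp add: l_def b_def)
  qed
  show ?thesis using *[OF assms(2)] *[OF assms(3)] by auto
qed

text \<open>Splitting off the lowest cycle is the source of all renewal equations below. Renewal
  words of length \<open>k\<close> are the numbers whose top \<open>r\<close> of \<open>k\<close>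
  digits vanish. If \<open>k - j < r\<close>, the truncated subtraction leaves only
  \<open>a = 0\<close>, which is the right remainder: the rest of the word then consists of zero
  cycles.\<close>

lemma sum_cycle_decomposition:
  fixes G :: "nat \<Rightarrow> 'a :: comm_monoid_add"
  assumes q: "q \<ge> 2" and k: "k \<ge> 1"
  shows "(\<Sum>n<q ^ (k - r). G n) =
    (\<Sum>j=1..k. \<Sum>b\<in>cycles q r j. \<Sum>a<q ^ (k - j - r). G (q ^ j * a + b))"
proof -
  define S where "S = (SIGMA j:{1..k}. SIGMA b:cycles q r j. {..<q ^ (k - j - r)})"
  define \<phi> where "\<phi> = (\<lambda>(j, b, a). q ^ j * a + b)"
  have mod: "(q ^ j * a + b) mod q ^ j = b" "(q ^ j * a + b) div q ^ j = a"
    if "b \<in> cycles q r j" for j a b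
    using cycles_less_power[OF q that] q by auto
  have inj: "inj_on \<phi> S"
  proof (rule inj_onI)
    fix x x' assume xx: "x \<in> S" "x' \<in> S" "\<phi> x = \<phi> x'"
    obtain j b a where x: "x = (j, b, a)" by (cases x)
    obtain j' b' a' where x': "x' = (j', b', a')" by (cases x')
    have S: "(j, b, a) \<in> S" "(j', b', a') \<in> S" and e: "\<phi> (j, b, a) = \<phi> (j', b', a')"
      using xx x x' by auto
    have c: "b \<in> cycles q r j" "b' \<in> cycles q r j'" using S by (auto simp: S_def)
    have e': "q ^ j * a + b = q ^ j' * a' + b'" using e by (simp add: \<phi>_def)
    have "j = j'" using cycle_unique[OF q, of "q ^ j * a + b" j r j'] c e' mod by metis
    then show "x = x'" unfolding x x' using e' c mod by metis
  qed
  have "\<phi> ` S = {..<q ^ (k - r)}"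
  proof (intro equalityI subsetI)
    fix n assume "n \<in> \<phi> ` S"
    then obtain j b a where S: "j \<in> {1..k}" "b \<in> cycles q r j" "a < q ^ (k - j - r)"
      "n = q ^ j * a + b" by (auto simp: S_def \<phi>_def)
    show "n \<in> {..<q ^ (k - r)}"
    proof (cases "j + r \<le> k")
      case True
      have "n < q ^ j * (a + 1)" using cycles_less_power[OF q S(2)] S(4) by simp
      also have "\<dots> \<le> q ^ j * q ^ (k - j - r)" using S(3) by (intro mult_left_mono) auto
      also have "\<dots> = q ^ (k - r)" using True by (simp flip: power_add)
      finally show ?thesis by simp
    next
      case False
      have "n < q ^ (j - r)" using False S cycles_less[OF q S(2)] by simp
      also have "q ^ (j - r) \<le> q ^ (k - r)" using S(1) q by (intro power_increasing) auto
      finally show ?thesis by simp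
    qed
  next
    fix n assume n: "n \<in> {..<q ^ (k - r)}"
    obtain j where j: "n mod q ^ j \<in> cycles q r j" using cycle_exists[OF q] by blast
    define b where "b = n mod q ^ j"
    define a where "a = n div q ^ j"
    have bj: "b \<in> cycles q r j" using j by (simp add: b_def)
    have "j \<le> k" using bj
    proof (cases rule: cycles_cases)
      case 2
      then have "b > 0" by (simp add: block_set_def)
      have "q ^ (floorlog q b - 1) \<le> b" by (rule floorlog_lower[OF q \<open>b > 0\<close>])
      also have "b \<le> n" by (simp add: b_def)
      also have "n < q ^ (k - r)" using n by simp
      finally have "floorlog q b - 1 < k - r" using q by (subst (asm) power_strict_increasing_iff) auto
      then show ?thesis using 2 by simp
    qed (use k in simp)
    moreover have "a < q ^ (k - j - r)"
    proof (cases "j \<le> k - r")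
      case True
      then have "q ^ (k - r - j) * q ^ j = q ^ (k - r)"
        by (metis le_add_diff_inverse2 power_add)
      then have "n < q ^ (k - r - j) * q ^ j" using n by simp
      then show ?thesis by (simp add: a_def less_mult_imp_div_less diff_commute add.commute)
    next
      case False
      have "q ^ (k - r) \<le> q ^ j" using False q by (intro power_increasing) auto
      then have "n < q ^ j" using n by simp
      then show ?thesis using q by (simp add: a_def)
    qed
    ultimately have "(j, b, a) \<in> S" using bj cycles_pos[OF q bj] by (auto simp: S_def)
    moreover have "n = \<phi> (j, b, a)" by (simp add: \<phi>_def a_def b_def)
    ultimately show "n \<in> \<phi> ` S" by blast
  qed
  then have "(\<Sum>n<q ^ (k - r). G n) = (\<Sum>x\<in>S. G (\<phi> x))"
    using sum.reindex[OF inj, of G] by simp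
  also have "\<dots> = (\<Sum>j=1..k. \<Sum>b\<in>cycles q r j. \<Sum>a<q ^ (k - j - r). G (q ^ j * a + b))"
    unfolding S_def \<phi>_def using finite_cycles[OF q] by (simp add: sum.Sigma split_def)
  finally show ?thesis .
qed

text \<open>Each of the \<open>m\<close> lowest chunks of \<open>R\<close> digits avoids one of its
  \<open>q ^ R\<close> values, while the \<open>s\<close> digits above them are free. The induction
  splits off the lowest chunk.\<close>

lemma card_nonzero_chunks:
  fixes q R :: nat
  assumes "q \<ge> 2"
  shows "card {n. n < q ^ (m * R + s) \<and> (\<forall>j<m. (n div q ^ (j * R)) mod q ^ R \<noteq> 0)}
    \<le> (q ^ R - 1) ^ m * q ^ s"
proof (induction m)
  case (Suc m)
  define D where "D m = {n. n < q ^ (m * R + s) \<and> (\<forall>j<m. (n div q ^ (j * R)) mod q ^ R \<noteq> 0)}" for m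
  have fin: "finite (D m)" for m by (rule finite_subset[of _ "{..<q ^ (m * R + s)}"]) (auto simp: D_def)
  have "card (D (Suc m)) \<le> card ({1..<q ^ R} \<times> D m)"
  proof (rule card_inj_on_le[of "\<lambda>n. (n mod q ^ R, n div q ^ R)"])
    show "inj_on (\<lambda>n. (n mod q ^ R, n div q ^ R)) (D (Suc m))"
      by (intro inj_onI) (metis Pair_inject div_mult_mod_eq)
    show "(\<lambda>n. (n mod q ^ R, n div q ^ R)) ` D (Suc m) \<subseteq> {1..<q ^ R} \<times> D m"
    proof clarify
      fix n assume n: "n \<in> D (Suc m)"
      have "n mod q ^ R \<noteq> 0" using n by (auto simp: D_def dest: spec[of _ 0])
      moreover have "n div q ^ R < q ^ (m * R + s)"
        using n by (auto simp: D_def power_add mult_ac intro: less_mult_imp_div_less)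
      moreover have "(n div q ^ R div q ^ (j * R)) mod q ^ R \<noteq> 0" if "j < m" for j
        using n that by (auto simp: D_def power_add div_mult2_eq dest: spec[of _ "Suc j"])
      ultimately show "n mod q ^ R \<in> {1..<q ^ R} \<and> n div q ^ R \<in> D m"
        using assms by (auto simp: D_def Suc_le_eq)
    qed
  qed (use fin in auto)
  also have "\<dots> \<le> (q ^ R - 1) * ((q ^ R - 1) ^ m * q ^ s)"
    using Suc by (simp add: card_cartesian_product D_def)
  finally show ?case by (simp add: D_def mult_ac)
qed simp

text \<open>After removal of its lowest digit, a block splits into chunks of \<open>r\<close> digits
  none of which vanishes, so each chunk costs a factor below 1 compared with all words. This decay
  makes every series below converge.\<close>

lemma card_cycles_le:
  assumes q: "q \<ge> 2"
  shows "\<exists>C \<theta>. C > 0 \<and> 0 < \<theta> \<and> \<theta> < 1 \<and> (\<forall>j. real (card (cycles q r j)) \<le> C * \<theta> ^ j * real q ^ j)"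
proof -
  \<comment> \<open>For \<open>r = 0\<close> this keeps the root and the division by
    \<open>R\<close> meaningful; blocks are single digits in that case and contain no full
    chunk.\<close>
  define R where "R = max r 1"
  have R1: "R \<ge> 1" by (simp add: R_def)
  define \<omega> where "\<omega> = 1 - 1 / real q ^ R"
  have q1: "real q ^ R > 1" using q R1 by (intro one_less_power) auto
  then have \<omega>: "0 < \<omega>" "\<omega> < 1" using q by (auto simp: \<omega>_def)
  define \<theta> where "\<theta> = root R \<omega>"
  have \<theta>: "0 < \<theta>" "\<theta> < 1" using \<omega> R1 by (auto simp: \<theta>_def)
  have \<theta>R: "\<theta> ^ R = \<omega>" using \<omega> R1 by (simp add: \<theta>_def)
  \<comment> \<open>The first term accounts for the zero cycle at \<open>j = 1\<close>. The second
    pays for the digits outside full chunks: the lowest one, the \<open>s < R\<close> leftover ones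
    and the \<open>r\<close> zeros.\<close>
  define C where "C = 1 / (\<theta> * real q) + 1 / \<theta> ^ (Suc R + r)"
  have pos: "\<theta> * real q > 0" using \<theta> q by simp
  have "real (card (cycles q r j)) \<le> C * \<theta> ^ j * real q ^ j" for j
  proof -
    define E where "E = {b \<in> block_set q r. floorlog q b + r = j}"
    have Ecyc: "E \<subseteq> cycles q r j" by (auto simp: E_def cycles_def)
    then have finE: "finite E" using finite_cycles[OF q] finite_subset by blast
    have "real (card (cycles q r j)) \<le> (if j = 1 then 1 else 0) + real (card E)"
    proof -
      have "card (cycles q r j) \<le> card E + card (if j = 1 then {0::nat} else {})"
        unfolding cycles_def E_def[symmetric] by (rule card_Un_le)
      then show ?thesis by auto
    qed
    also have "(if j = 1 then 1 else 0 :: real) \<le> 1 / (\<theta> * real q) * (\<theta> ^ j * real q ^ j)"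
      using \<theta> q by auto
    also have "real (card E) \<le> 1 / \<theta> ^ (Suc R + r) * (\<theta> ^ j * real q ^ j)"
    proof (cases "E = {}")
      case True
      then show ?thesis using \<theta> q by simp
    next
      case False
      then obtain b0 where b0: "b0 \<in> E" by blast
      define l where "l = j - r"
      have "b0 > 0" "j = floorlog q b0 + r" using b0 by (auto simp: E_def block_set_def)
      then have l1: "l \<ge> 1" and j: "j = l + r" using floorlog_pos[OF q] by (auto simp: l_def Suc_le_eq)
      define m where "m = (l - 1) div R"
      define s where "s = (l - 1) mod R"
      have lms: "l = Suc (m * R + s)" using l1 by (simp add: m_def s_def)
      have sR: "s < R" using R1 by (simp add: s_def)
      define D where "D = {n. n < q ^ (m * R + s) \<and> (\<forall>j<m. (n div q ^ (j * R)) mod q ^ R \<noteq> 0)}"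
      have finD: "finite D" by (rule finite_subset[of _ "{..<q ^ (m * R + s)}"]) (auto simp: D_def)
      have "card E \<le> card ({..<q} \<times> D)"
      proof (rule card_inj_on_le[of "\<lambda>n. (n mod q, n div q)"])
        show "inj_on (\<lambda>n. (n mod q, n div q)) E"
          by (intro inj_onI) (metis Pair_inject div_mult_mod_eq)
        show "(\<lambda>n. (n mod q, n div q)) ` E \<subseteq> {..<q} \<times> D"
        proof clarify
          fix b assume b: "b \<in> E"
          then have fl: "floorlog q b = l" and bb: "b \<in> block_set q r"
            by (auto simp: E_def l_def)
          have "b < q ^ l" using floorlog_upper[OF q, of b] fl by simp
          then have "b div q < q ^ (m * R + s)"
            by (simp add: lms less_mult_imp_div_less mult.commute)
          moreover have "(b div q div q ^ (i * R)) mod q ^ R \<noteq> 0" if i: "i < m" for i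
          proof -
            have "Suc (i * R) + R \<le> l"
            proof -
              have "Suc i * R \<le> m * R" using i by (intro mult_right_mono) auto
              then show ?thesis by (simp add: lms)
            qed
            then have *: "Suc (i * R) < l" using R1 by linarith
            then have "(b div q ^ Suc (i * R)) mod q ^ r \<noteq> 0"
              using bb fl unfolding block_set_iff[OF q] by auto
            moreover from this have "R = r" by (cases "r = 0") (auto simp: R_def)
            ultimately show ?thesis by (simp add: div_mult2_eq)
          qed
          ultimately show "b mod q \<in> {..<q} \<and> b div q \<in> D" using q by (auto simp: D_def)
        qed
      qed (use finD in auto)
      also have "\<dots> \<le> q * ((q ^ R - 1) ^ m * q ^ s)"
        using card_nonzero_chunks[OF q, of m R s] by (simp add: card_cartesian_product D_def)
      finally have "real (card E) \<le> real (q * ((q ^ R - 1) ^ m * q ^ s))" by (rule of_nat_mono)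
      also have "\<dots> = real q * ((real q ^ R - 1) ^ m * real q ^ s)"
        using q by (simp add: of_nat_diff)
      also have "real q ^ R - 1 = \<omega> * real q ^ R" using q by (simp add: \<omega>_def field_simps)
      also have "real q * ((\<omega> * real q ^ R) ^ m * real q ^ s) = \<omega> ^ m * real q ^ l"
        by (simp add: lms power_mult_distrib power_add power_mult mult_ac flip: power_mult)
      finally have 1: "real (card E) \<le> \<omega> ^ m * real q ^ l" .
      have "\<omega> ^ m = \<theta> ^ (m * R)" by (simp add: mult.commute power_mult flip: \<theta>R)
      also have "\<theta> ^ (m * R) \<le> 1 / \<theta> ^ (Suc R + r) * \<theta> ^ j"
      proof -
        have "\<theta> ^ (m * R) * \<theta> ^ (Suc R + r) = \<theta> ^ (m * R + Suc R + r)"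
          by (simp add: power_add)
        also have "\<dots> \<le> \<theta> ^ j" using \<theta> sR by (intro power_decreasing) (auto simp: j lms)
        finally show ?thesis using \<theta> by (simp add: field_simps)
      qed
      finally have 2: "\<omega> ^ m \<le> 1 / \<theta> ^ (Suc R + r) * \<theta> ^ j" .
      have 3: "real q ^ l \<le> real q ^ j" using q by (intro power_increasing) (auto simp: j)
      have "\<omega> ^ m * real q ^ l \<le> (1 / \<theta> ^ (Suc R + r) * \<theta> ^ j) * real q ^ j"
        using \<theta> by (intro mult_mono 2 3) auto
      then show ?thesis using 1 by (simp only: mult.assoc)
    qed
    finally show ?thesis by (simp add: C_def algebra_simps)
  qed
  moreover have "C > 0" using \<theta> q by (auto simp: C_def intro!: add_pos_pos divide_pos_pos)
  ultimately show ?thesis using \<theta> by blast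
qed

section \<open>The generating function of the blocks and its derivatives\<close>

lemma summable_power_times_geometric:
  fixes w :: real
  assumes "0 \<le> w" "w < 1"
  shows "summable (\<lambda>n. real n ^ i * w ^ n)"
proof (rule root_test_convergence)
  have "eventually (\<lambda>n. root n (norm (real n ^ i * w ^ n)) = root n (real n) ^ i * w) sequentially"
    using eventually_gt_at_top[of 0]
  proof eventually_elim
    case (elim n)
    then show ?case using assms
      by (simp add: norm_mult norm_power real_root_mult real_root_power real_root_power_cancel)
  qed
  moreover have "(\<lambda>n. root n (real n) ^ i * w) \<longlonglongrightarrow> 1 ^ i * w"
    by (intro tendsto_intros LIMSEQ_root)
  ultimately show "(\<lambda>n. root n (norm (real n ^ i * w ^ n))) \<longlonglongrightarrow> 1 ^ i * w"
    using tendsto_cong by fast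
qed (use assms in simp)

section \<open>Additivity and linear growth of the logarithm of f\<close>

locale positive_quasimultiplicative =
  fixes q r :: nat and f :: "nat \<Rightarrow> real"
  assumes q: "q \<ge> 2"
    and quasi: "quasimultiplicative q r f"
    and pos: "\<And>n. f n > 0"
    and growth: "poly_growth f"
begin

definition h :: "nat \<Rightarrow> real" where "h n = ln (f n)"

lemma f_append: "b < q ^ k \<Longrightarrow> f (q ^ (k + r) * a + b) = f a * f b"
  using quasi by (auto simp: quasimultiplicative_def)

lemma f_0: "f 0 = 1"
  using f_append[of 0 0 0] pos[of 0] by simp

text \<open>The functional equation only inserts at least \<open>r\<close> zeros at a time. A single
  zero is obtained by evaluating \<open>f\<close> at q^(r+1) n in two ways, with
  \<open>k = 0\<close> and with \<open>k = 1\<close>.\<close>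

lemma f_mult_q: "f (q * n) = f n"
proof -
  have "f (q ^ r * (q * n)) = f (q * n)" using f_append[of 0 0 "q * n"] f_0 by simp
  moreover have "f (q ^ (1 + r) * n) = f n" using f_append[of 0 1 n] f_0 q by simp
  ultimately show ?thesis by (simp add: mult_ac)
qed

lemma f_cycle:
  assumes "b \<in> cycles q r j"
  shows "f (q ^ j * a + b) = f a * f b"
  using assms
proof (cases rule: cycles_cases)
  case 1
  then show ?thesis by (simp add: f_mult_q f_0)
next
  case 2
  then show ?thesis using f_append[OF floorlog_upper[OF q, of b], of a] by simp
qed

lemma h_0 [simp]: "h 0 = 0"
  by (simp add: h_def f_0)

lemma h_cycle: "b \<in> cycles q r j \<Longrightarrow> h (q ^ j * a + b) = h a + h b"
  using f_cycle[of b j a] pos[of a] pos[of b] by (simp add: h_def ln_mult)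

text \<open>The two growth bounds say |log f(n)| <= c log n + O(1), and log n is at most the length
  of \<open>n\<close> times log q. Additive constants and finitely many exceptions are absorbed,
  since positive numbers have length at least 1 and \<open>h 0 = 0\<close>.\<close>

lemma abs_h_le: "\<exists>K\<ge>0. \<forall>n. \<bar>h n\<bar> \<le> K * real (floorlog q n)"
proof -
  obtain c where c: "c \<ge> 0" "f \<in> O(\<lambda>n. real n powr c)" "f \<in> \<Omega>(\<lambda>n. real n powr (- c))"
    using growth by (auto simp: poly_growth_def)
  obtain C1 where C1: "C1 > 0" "\<forall>\<^sub>F n in at_top. norm (f n) \<le> C1 * norm (real n powr c)"
    using c(2) by (elim landau_o.bigE)
  have "(\<lambda>n. real n powr (- c)) \<in> O(f)" using c(3) by (simp add: bigomega_iff_bigo)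
  then obtain C2 where C2: "C2 > 0" "\<forall>\<^sub>F n in at_top. norm (real n powr (- c)) \<le> C2 * norm (f n)"
    by (elim landau_o.bigE)
  define M where "M = \<bar>ln C1\<bar> + \<bar>ln C2\<bar> + c * ln (real q)"
  have lnq: "ln (real q) \<ge> 0" using q by simp
  have "\<forall>\<^sub>F n in at_top. \<bar>h n\<bar> \<le> M * real (floorlog q n)"
    using C1(2) C2(2) eventually_gt_at_top[of 0]
  proof eventually_elim
    case (elim n)
    have fl: "real (floorlog q n) \<ge> 1" using floorlog_pos[OF q, of n] elim by simp
    have "real n < real (q ^ floorlog q n)" using floorlog_upper[OF q, of n] by (simp only: of_nat_less_iff)
    then have "ln (real n) \<le> ln (real q ^ floorlog q n)" using elim
      by (intro ln_mono) (auto simp flip: of_nat_power)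
    also have "\<dots> = real (floorlog q n) * ln (real q)" using q by (simp add: ln_realpow)
    finally have "c * ln (real n) \<le> c * (real (floorlog q n) * ln (real q))"
      using c(1) by (rule mult_left_mono)
    moreover have "h n \<le> ln C1 + c * ln (real n)"
    proof -
      have "f n \<le> C1 * real n powr c" using elim pos[of n] by simp
      then have "h n \<le> ln (C1 * real n powr c)" using pos[of n] by (simp add: h_def)
      then show ?thesis using C1(1) elim by (simp add: ln_mult ln_powr)
    qed
    moreover have "- h n \<le> ln C2 + c * ln (real n)"
    proof -
      have "real n powr (- c) \<le> C2 * f n" using elim pos[of n] by simp
      then have "ln (real n powr (- c)) \<le> ln (C2 * f n)" using elim pos[of n] by (intro ln_mono) auto
      then show ?thesis using C2(1) elim pos[of n] by (simp add: ln_mult ln_powr h_def)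
    qed
    moreover have "\<bar>ln C1\<bar> \<le> \<bar>ln C1\<bar> * real (floorlog q n)" "\<bar>ln C2\<bar> \<le> \<bar>ln C2\<bar> * real (floorlog q n)"
      using mult_left_mono[OF fl, of "\<bar>ln C1\<bar>"] mult_left_mono[OF fl, of "\<bar>ln C2\<bar>"] by auto
    ultimately show ?case unfolding M_def distrib_right
      by (simp add: mult_ac abs_le_iff)
  qed
  then obtain N where N: "\<And>n. n \<ge> N \<Longrightarrow> \<bar>h n\<bar> \<le> M * real (floorlog q n)"
    by (auto simp: eventually_at_top_linorder)
  define K where "K = M + (\<Sum>n<N. \<bar>h n\<bar>)"
  have M0: "M \<ge> 0" using c(1) lnq by (simp add: M_def)
  have S0: "(\<Sum>n<N. \<bar>h n\<bar>) \<ge> 0" by (intro sum_nonneg) auto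
  have "\<bar>h n\<bar> \<le> K * real (floorlog q n)" for n
  proof (cases "n \<ge> N")
    case True
    have "M * real (floorlog q n) \<le> K * real (floorlog q n)"
      using S0 by (intro mult_right_mono) (auto simp: K_def)
    then show ?thesis using N[OF True] by linarith
  next
    case False
    show ?thesis
    proof (cases "n = 0")
      case n: False
      then have fl: "real (floorlog q n) \<ge> 1" using floorlog_pos[OF q, of n] by simp
      have "\<bar>h n\<bar> \<le> (\<Sum>n<N. \<bar>h n\<bar>)" using False by (intro member_le_sum) auto
      also have "\<dots> \<le> K" using M0 by (simp add: K_def)
      also have "\<dots> \<le> K * real (floorlog q n)"
        using mult_left_mono[OF fl, of K] M0 S0 by (simp add: K_def)
      finally show ?thesis .
    qed (simp add: floorlog_def)
  qed
  moreover have "K \<ge> 0" using M0 S0 by (simp add: K_def)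
  ultimately show ?thesis by blast
qed

definition hK :: real where "hK = (SOME K. K \<ge> 0 \<and> (\<forall>n. \<bar>h n\<bar> \<le> K * real (floorlog q n)))"

lemma hK_nonneg: "hK \<ge> 0" and abs_h: "\<bar>h n\<bar> \<le> hK * real (floorlog q n)"
  using someI_ex[OF abs_h_le[unfolded Bex_def]] unfolding hK_def[symmetric] by auto

lemma abs_h_cycle:
  assumes "b \<in> cycles q r j"
  shows "\<bar>h b\<bar> \<le> hK * real j"
  using assms
proof (cases rule: cycles_cases)
  case 1
  then show ?thesis using hK_nonneg by simp
next
  case 2
  have "hK * real (floorlog q b) \<le> hK * real j" using 2 hK_nonneg by (intro mult_left_mono) auto
  then show ?thesis using abs_h[of b] by linarith
qed

section \<open>Termwise differentiation of B as a power series in x\<close>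

definition blocks :: "nat \<Rightarrow> nat set" where
  "blocks l = {b \<in> block_set q r. floorlog q b = l}"

lemma blocks_subset_cycles: "blocks l \<subseteq> cycles q r (l + r)"
  by (auto simp: blocks_def cycles_def)

lemma finite_blocks: "finite (blocks l)"
  using blocks_subset_cycles finite_cycles[OF q] finite_subset by blast

lemma sum_cycles_eq_blocks:
  assumes "g 0 = (0 :: real)"
  shows "sum g (cycles q r (l + r)) = sum g (blocks l)"
  using assms finite_cycles[OF q, of r "l + r"]
  by (intro sum.mono_neutral_right blocks_subset_cycles)
     (auto simp: cycles_def blocks_def split: if_splits)

text \<open>This is the coefficient of \<open>x ^ l\<close> in the i-th t-derivative of B; it is a
  finite sum because there are finitely many blocks of each length.\<close>

definition D :: "nat \<Rightarrow> nat \<Rightarrow> real \<Rightarrow> real" where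
  "D i l t = (\<Sum>b\<in>blocks l. h b ^ i * exp (t * h b))"

lemma D_has_derivative: "(D i l has_field_derivative D (Suc i) l t) (at t within A)"
  unfolding D_def by (auto intro!: derivative_eq_intros sum.cong simp: mult_ac)

lemma abs_D_le:
  assumes "\<bar>t\<bar> \<le> t0"
  shows "\<bar>D i l t\<bar> \<le> (hK * real l) ^ i * (real (card (blocks l)) * exp (t0 * hK * real l))"
proof -
  have "\<bar>D i l t\<bar> \<le> (\<Sum>b\<in>blocks l. \<bar>h b ^ i * exp (t * h b)\<bar>)"
    unfolding D_def by (rule sum_abs)
  also have "\<dots> \<le> (\<Sum>b\<in>blocks l. (hK * real l) ^ i * exp (t0 * hK * real l))"
  proof (rule sum_mono)
    fix b assume "b \<in> blocks l"
    then have b: "\<bar>h b\<bar> \<le> hK * real l" using abs_h[of b] by (auto simp: blocks_def)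
    have "t * h b \<le> \<bar>t\<bar> * \<bar>h b\<bar>" by (metis abs_ge_self abs_mult)
    also have "\<dots> \<le> t0 * (hK * real l)" using assms b by (intro mult_mono) auto
    finally have "exp (t * h b) \<le> exp (t0 * hK * real l)" by (simp add: mult_ac)
    moreover have "\<bar>h b\<bar> ^ i \<le> (hK * real l) ^ i" using b by (intro power_mono) auto
    ultimately show "\<bar>h b ^ i * exp (t * h b)\<bar> \<le> (hK * real l) ^ i * exp (t0 * hK * real l)"
      unfolding abs_mult power_abs abs_exp_cancel using hK_nonneg by (intro mult_mono) auto
  qed
  finally show ?thesis by (simp add: mult_ac)
qed

lemma block_series_convergence:
  obtains x1 t0 where "x1 > 1 / real q" "t0 > 0"
    "\<And>i. summable (\<lambda>l. real l ^ i * (x1 ^ l * (real (card (blocks l)) * exp (t0 * hK * real l))))"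
proof -
  obtain C \<theta> where C: "C > 0" "0 < \<theta>" "\<theta> < 1"
    "\<And>j. real (card (cycles q r j)) \<le> C * \<theta> ^ j * real q ^ j"
    using card_cycles_le[OF q, of r] by blast
  \<comment> \<open>The decay \<open>\<theta> ^ l\<close> is spent in three equal parts: one
    enlarges the range of \<open>x\<close> beyond \<open>1 / q\<close>, one pays for
    \<open>exp (t0 * hK * l)\<close>, and one remains for convergence. In \<open>t0\<close> the
    denominator \<open>hK + 1\<close> avoids a division by zero.\<close>
  define \<omega> where "\<omega> = root 3 \<theta>"
  have \<omega>: "0 < \<omega>" "\<omega> < 1" "\<omega> ^ 3 = \<theta>" using C by (auto simp: \<omega>_def)
  define x1 where "x1 = 1 / (\<omega> * real q)"
  define t0 where "t0 = ln (1 / \<omega>) / (hK + 1)"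
  have "ln (1 / \<omega>) > 0" using \<omega> by simp
  then have t0: "t0 > 0" using hK_nonneg by (simp add: t0_def)
  have "t0 * hK \<le> t0 * (hK + 1)" using t0 by simp
  also have "\<dots> = ln (1 / \<omega>)" using hK_nonneg by (simp add: t0_def)
  finally have "exp (t0 * hK) \<le> exp (ln (1 / \<omega>))" by simp
  then have e: "exp (t0 * hK) \<le> 1 / \<omega>" using \<omega> by simp
  have bound: "x1 ^ l * (real (card (blocks l)) * exp (t0 * hK * real l)) \<le> C * real q ^ r * \<omega> ^ l" for l
  proof -
    have "card (blocks l) \<le> card (cycles q r (l + r))"
      by (intro card_mono finite_cycles q blocks_subset_cycles)
    then have "real (card (blocks l)) \<le> C * \<theta> ^ (l + r) * real q ^ (l + r)"
      using C(4)[of "l + r"] by linarith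
    also have "\<dots> = C * real q ^ r * (\<omega> ^ 3 * real q) ^ l * \<theta> ^ r"
      by (simp add: power_add power_mult_distrib mult_ac \<omega>(3))
    also have "\<dots> \<le> C * real q ^ r * (\<omega> ^ 3 * real q) ^ l * 1"
      using C \<omega> by (intro mult_left_mono power_le_one) auto
    finally have c: "real (card (blocks l)) \<le> C * real q ^ r * (\<omega> ^ 3 * real q) ^ l" by simp
    have "exp (t0 * hK * real l) = exp (t0 * hK) ^ l" by (simp add: exp_of_nat2_mult)
    also have "\<dots> \<le> (1 / \<omega>) ^ l" using e by (intro power_mono) auto
    finally have "x1 ^ l * (real (card (blocks l)) * exp (t0 * hK * real l))
      \<le> x1 ^ l * ((C * real q ^ r * (\<omega> ^ 3 * real q) ^ l) * (1 / \<omega>) ^ l)"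
      using c \<omega> C by (intro mult_left_mono mult_mono) (auto simp: x1_def)
    also have "\<dots> = C * real q ^ r * (x1 * (\<omega> ^ 3 * real q) * (1 / \<omega>)) ^ l"
      by (simp only: power_mult_distrib mult_ac)
    also have "x1 * (\<omega> ^ 3 * real q) * (1 / \<omega>) = \<omega>"
      using \<omega>(1) q by (simp add: x1_def power3_eq_cube)
    finally show ?thesis .
  qed
  show thesis
  proof (rule that)
    show "x1 > 1 / real q" using \<omega> q by (simp add: x1_def field_simps)
    show "t0 > 0" by fact
    fix i
    have "summable (\<lambda>l. C * real q ^ r * (real l ^ i * \<omega> ^ l))"
      using \<omega> by (intro summable_mult summable_power_times_geometric) auto
    then show "summable (\<lambda>l. real l ^ i * (x1 ^ l * (real (card (blocks l)) * exp (t0 * hK * real l))))"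
    proof (rule summable_comparison_test')
      fix l :: nat
      have "x1 > 0" using \<omega> q by (simp add: x1_def)
      then have "norm (real l ^ i * (x1 ^ l * (real (card (blocks l)) * exp (t0 * hK * real l)))) =
        real l ^ i * (x1 ^ l * (real (card (blocks l)) * exp (t0 * hK * real l)))"
        by simp
      also have "\<dots> \<le> real l ^ i * (C * real q ^ r * \<omega> ^ l)"
        using bound[of l] by (intro mult_left_mono) auto
      finally show "norm (real l ^ i * (x1 ^ l * (real (card (blocks l)) * exp (t0 * hK * real l))))
        \<le> C * real q ^ r * (real l ^ i * \<omega> ^ l)" by (simp add: mult_ac)
    qed
  qed
qed

text \<open>All terms are nonnegative, so the unordered sum over blocks may be taken length by
  length.\<close>

lemma BB_eq_suminf:
  assumes "x \<ge> 0" "summable (\<lambda>l. x ^ l * D 0 l t)"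
  shows "BB q r f x t = (\<Sum>l. x ^ l * D 0 l t)"
proof -
  define F where "F = (\<lambda>(l::nat, b). x ^ l * f b powr t)"
  have hs: "((\<lambda>b. F (l, b)) has_sum x ^ l * D 0 l t) (blocks l)" for l
  proof -
    have "((\<lambda>b. F (l, b)) has_sum (\<Sum>b\<in>blocks l. F (l, b))) (blocks l)"
      by (intro has_sum_finite finite_blocks)
    also have "(\<Sum>b\<in>blocks l. F (l, b)) = x ^ l * D 0 l t"
      using pos by (simp add: F_def D_def sum_distrib_left powr_def h_def less_imp_neq[symmetric])
    finally show ?thesis .
  qed
  have D0: "D 0 l t \<ge> 0" for l unfolding D_def by (intro sum_nonneg) auto
  have g: "((\<lambda>l. x ^ l * D 0 l t) has_sum (\<Sum>l. x ^ l * D 0 l t)) UNIV"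
    using assms D0 by (intro sums_nonneg_imp_has_sum summable_sums) auto
  have "F summable_on (SIGMA l:UNIV. blocks l)"
    by (rule summable_on_SigmaI[OF hs]) (use g assms in \<open>auto simp: F_def summable_on_def\<close>)
  then have "(F has_sum (\<Sum>l. x ^ l * D 0 l t)) (SIGMA l:UNIV. blocks l)"
    by (intro has_sum_SigmaI[OF hs g])
  moreover have "bij_betw (\<lambda>b. (floorlog q b, b)) (block_set q r) (SIGMA l:UNIV. blocks l)"
    by (rule bij_betwI[where g = snd]) (auto simp: blocks_def)
  ultimately have "((\<lambda>b. F (floorlog q b, b)) has_sum (\<Sum>l. x ^ l * D 0 l t)) (block_set q r)"
    using has_sum_reindex_bij_betw[of "\<lambda>b. (floorlog q b, b)" _ _ F] by auto
  then show ?thesis unfolding BB_def F_def by (simp add: infsumI)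
qed

text \<open>On a neighbourhood of (1/q, 0) the series have a common summable majorant, so they can
  be differentiated termwise. As the second derivatives are nested uses of \<open>deriv\<close>, the
  first derivative is identified with its series at all nearby arguments.\<close>

lemma B_derivative_sums:
  shows "(\<lambda>l. D 1 l 0 / real q ^ l) sums B_t q r f"
    and "(\<lambda>l. D 2 l 0 / real q ^ l) sums B_tt q r f"
    and "(\<lambda>l. real l * (D 1 l 0 / real q ^ l)) sums (B_tx q r f / real q)"
proof -
  obtain x1 t0 where x1: "x1 > 1 / real q" and t0: "t0 > 0" and
    sm: "\<And>i. summable (\<lambda>l. real l ^ i * (x1 ^ l * (real (card (blocks l)) * exp (t0 * hK * real l))))"
    using block_series_convergence by blast
  have q0: "1 / real q > 0" using q by simp
  then have x10: "x1 > 0" using x1 by linarith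
  define M where "M i l = hK ^ i * (real l ^ i * (x1 ^ l * (real (card (blocks l)) * exp (t0 * hK * real l))))" for i l
  have M: "summable (M i)" for i unfolding M_def by (intro summable_mult sm)
  have term_le: "norm (x ^ l * D i l t) \<le> M i l" if "\<bar>x\<bar> \<le> x1" "\<bar>t\<bar> < t0" for x t i l
  proof -
    have "\<bar>x\<bar> ^ l * \<bar>D i l t\<bar> \<le> x1 ^ l * ((hK * real l) ^ i * (real (card (blocks l)) * exp (t0 * hK * real l)))"
      using that by (intro mult_mono abs_D_le power_mono) (auto simp: x10 less_imp_le)
    then show ?thesis by (simp add: M_def abs_mult power_abs power_mult_distrib mult_ac)
  qed
  have summ: "summable (\<lambda>l. x ^ l * D i l t)" if "\<bar>x\<bar> \<le> x1" "\<bar>t\<bar> < t0" for x t i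
    using M[of i] by (rule summable_comparison_test') (use term_le that in auto)
  have der: "((\<lambda>t. \<Sum>l. x ^ l * D i l t) has_field_derivative (\<Sum>l. x ^ l * D (Suc i) l t)) (at t)"
    if "\<bar>x\<bar> \<le> x1" "\<bar>t\<bar> < t0" for x t i
  proof (rule has_field_derivative_series'(2)[of "{-t0<..<t0}"])
    show "uniformly_convergent_on {-t0<..<t0} (\<lambda>n t. \<Sum>l<n. x ^ l * D (Suc i) l t)"
      by (rule Weierstrass_m_test'[OF _ M[of "Suc i"]]) (use term_le that in auto)
    show "t \<in> interior {-t0<..<t0}" using that by (auto simp: interior_open)
    show "summable (\<lambda>l. x ^ l * D i l 0)" using summ that t0 by simp
  qed (use t0 in \<open>auto intro!: DERIV_cmult D_has_derivative\<close>)
  have BBe: "BB q r f x t = (\<Sum>l. x ^ l * D 0 l t)" if "0 \<le> x" "x \<le> x1" "\<bar>t\<bar> < t0" for x t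
    using BB_eq_suminf summ that by simp
  have d1: "deriv (BB q r f x) t = (\<Sum>l. x ^ l * D 1 l t)" if "0 \<le> x" "x \<le> x1" "\<bar>t\<bar> < t0" for x t
  proof (rule DERIV_imp_deriv)
    have "\<forall>\<^sub>F t in nhds t. t \<in> {-t0<..<t0}"
      using that by (intro eventually_nhds_in_open) auto
    then have "\<forall>\<^sub>F t in nhds t. BB q r f x t = (\<Sum>l. x ^ l * D 0 l t)"
      by eventually_elim (use BBe that in auto)
    then show "(BB q r f x has_field_derivative (\<Sum>l. x ^ l * D 1 l t)) (at t)"
      using der[of x t 0] that by (subst DERIV_cong_ev[OF refl _ refl]) auto
  qed
  have xq: "0 \<le> 1 / real q" "1 / real q \<le> x1" using x1 q0 by auto
  have pw: "(1 / real q) ^ l * c = c / real q ^ l" for l c by (simp add: power_divide)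
  have "B_t q r f = (\<Sum>l. (1 / real q) ^ l * D 1 l 0)"
    unfolding B_t_def using d1[OF xq, of 0] t0 by simp
  then show "(\<lambda>l. D 1 l 0 / real q ^ l) sums B_t q r f"
    using summ[of "1 / real q" 0 1] xq t0 by (simp add: pw sums_iff)
  have "B_tt q r f = (\<Sum>l. (1 / real q) ^ l * D 2 l 0)"
    unfolding B_tt_def
  proof (rule DERIV_imp_deriv)
    have "\<forall>\<^sub>F t in nhds 0. t \<in> {-t0<..<t0}"
      using t0 by (intro eventually_nhds_in_open) auto
    then have "\<forall>\<^sub>F t in nhds 0. deriv (BB q r f (1 / real q)) t = (\<Sum>l. (1 / real q) ^ l * D 1 l t)"
      by eventually_elim (use d1[OF xq] in auto)
    then show "((\<lambda>t. deriv (BB q r f (1 / real q)) t) has_field_derivative (\<Sum>l. (1 / real q) ^ l * D 2 l 0)) (at 0)"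
      using der[of "1 / real q" 0 1] xq t0
      by (subst DERIV_cong_ev[OF refl _ refl]) (auto simp: numeral_2_eq_2)
  qed
  then show "(\<lambda>l. D 2 l 0 / real q ^ l) sums B_tt q r f"
    using summ[of "1 / real q" 0 2] xq t0 by (simp add: pw sums_iff)
  define c where "c l = D 1 l 0" for l
  \<comment> \<open>One factor \<open>l\<close> comes from the derivative in \<open>x\<close>, the
    other from \<open>\<bar>h b\<bar> \<le> hK * l\<close>; the factor \<open>1 / x1\<close> makes
    up for the exponent \<open>l - 1\<close>.\<close>
  have t_le: "norm (real l * x ^ (l - 1) * c l) \<le> hK / x1 * (real l ^ 2 * (x1 ^ l * (real (card (blocks l)) * exp (t0 * hK * real l))))"
    if "0 < x" "x < x1" for x l
  proof (cases "l = 0")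
    case False
    then obtain m where l: "l = Suc m" by (cases l) auto
    have "x ^ m \<le> x1 ^ m" using that by (intro power_mono) auto
    moreover have "\<bar>c l\<bar> \<le> (hK * real l) ^ 1 * (real (card (blocks l)) * exp (t0 * hK * real l))"
      unfolding c_def using t0 by (intro abs_D_le) auto
    ultimately have "x ^ m * \<bar>c l\<bar> \<le> x1 ^ m * ((hK * real l) ^ 1 * (real (card (blocks l)) * exp (t0 * hK * real l)))"
      using x10 by (intro mult_mono) auto
    then have "real l * (x ^ m * \<bar>c l\<bar>) \<le> real l * (x1 ^ m * ((hK * real l) ^ 1 * (real (card (blocks l)) * exp (t0 * hK * real l))))"
      by (intro mult_left_mono) auto
    also have "\<dots> = hK / x1 * (real l ^ 2 * (x1 ^ l * (real (card (blocks l)) * exp (t0 * hK * real l))))"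
      using x10 by (simp add: l power2_eq_square)
    finally show ?thesis using that by (simp add: l abs_mult mult_ac)
  qed simp
  have "((\<lambda>x. \<Sum>l. x ^ l * c l) has_field_derivative (\<Sum>l. real l * (1 / real q) ^ (l - 1) * c l)) (at (1 / real q))"
  proof (rule has_field_derivative_series'(2)[of "{0<..<x1}"])
    show "uniformly_convergent_on {0<..<x1} (\<lambda>n x. \<Sum>l<n. real l * x ^ (l - 1) * c l)"
      by (rule Weierstrass_m_test'[OF _ summable_mult[OF sm[of 2], of "hK / x1"]])
         (use t_le in auto)
    show "1 / real q \<in> interior {0<..<x1}" using x1 q0 by (simp add: interior_open)
    show "1 / real q \<in> {0<..<x1}" using x1 q0 by simp
    show "summable (\<lambda>l. (1 / real q) ^ l * c l)"
      using summ[of "1 / real q" 0 1] xq t0 by (simp add: c_def)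
    show "((\<lambda>x. x ^ l * c l) has_field_derivative real l * x ^ (l - 1) * c l) (at x within {0<..<x1})" for l x
      by (auto intro!: derivative_eq_intros)
  qed simp
  moreover have "\<forall>\<^sub>F x in nhds (1 / real q). deriv (BB q r f x) 0 = (\<Sum>l. x ^ l * c l)"
  proof -
    have "\<forall>\<^sub>F x in nhds (1 / real q). x \<in> {0<..<x1}"
      using x1 q0 by (intro eventually_nhds_in_open) auto
    then show ?thesis by eventually_elim (use d1 t0 in \<open>auto simp: c_def\<close>)
  qed
  ultimately have "((\<lambda>x. deriv (BB q r f x) 0) has_field_derivative
      (\<Sum>l. real l * (1 / real q) ^ (l - 1) * c l)) (at (1 / real q))"
    by (subst DERIV_cong_ev[OF refl _ refl]) auto
  then have Btx: "B_tx q r f = (\<Sum>l. real l * (1 / real q) ^ (l - 1) * c l)"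
    unfolding B_tx_def by (rule DERIV_imp_deriv)
  have "summable (\<lambda>l. real l * (1 / real q) ^ (l - 1) * c l)"
    using summable_mult[OF sm[of 2], of "hK / x1"]
    by (rule summable_comparison_test') (use t_le x1 q0 in auto)
  then have "(\<lambda>l. real l * (1 / real q) ^ (l - 1) * c l / real q) sums (B_tx q r f / real q)"
    unfolding Btx by (intro sums_divide summable_sums)
  also have "(\<lambda>l. real l * (1 / real q) ^ (l - 1) * c l / real q) = (\<lambda>l. real l * (D 1 l 0 / real q ^ l))"
  proof
    show "real l * (1 / real q) ^ (l - 1) * c l / real q = real l * (D 1 l 0 / real q ^ l)" for l
      using q by (cases l) (auto simp: c_def power_divide field_simps)
  qed
  finally show "(\<lambda>l. real l * (D 1 l 0 / real q ^ l)) sums (B_tx q r f / real q)" .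
qed

definition H :: "nat \<Rightarrow> nat \<Rightarrow> real" where
  "H i j = (\<Sum>b\<in>cycles q r j. h b ^ i) / real q ^ j"

text \<open>The zero cycle has reward 0 and drops out of moments of positive order; what remains are
  blocks, shifted by their \<open>r\<close> zeros.\<close>

lemma H_shift: "i > 0 \<Longrightarrow> H i (l + r) = D i l 0 / real q ^ l / real q ^ r"
  using sum_cycles_eq_blocks[of "\<lambda>b. h b ^ i" l] by (simp add: H_def D_def power_add)

lemma H_small: "i > 0 \<Longrightarrow> j < r \<Longrightarrow> H i j = 0"
  unfolding H_def by (auto intro!: sum.neutral simp: cycles_def split: if_splits)

lemma H_sums:
  shows "H 1 sums (B_t q r f / real q ^ r)"
    and "H 2 sums (B_tt q r f / real q ^ r)"
    and "(\<lambda>j. real j * H 1 j) sums ((B_tx q r f / real q + real r * B_t q r f) / real q ^ r)"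
proof -
  have shift: "g sums s" if "(\<lambda>l. g (l + r)) sums s" "\<And>j. j < r \<Longrightarrow> g j = 0" for g :: "nat \<Rightarrow> real" and s
    using that sums_iff_shift'[of g r s] by simp
  show "H 1 sums (B_t q r f / real q ^ r)"
    by (rule shift) (use H_shift[of 1] H_small[of 1] sums_divide[OF B_derivative_sums(1), of "real q ^ r"] in simp_all)
  show "H 2 sums (B_tt q r f / real q ^ r)"
    by (rule shift) (use H_shift[of 2] H_small[of 2] sums_divide[OF B_derivative_sums(2), of "real q ^ r"] in simp_all)
  have "(\<lambda>l. (real l * (D 1 l 0 / real q ^ l) + real r * (D 1 l 0 / real q ^ l)) / real q ^ r)
    sums ((B_tx q r f / real q + real r * B_t q r f) / real q ^ r)"
    by (intro sums_divide sums_add sums_mult B_derivative_sums)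
  also have "(\<lambda>l. (real l * (D 1 l 0 / real q ^ l) + real r * (D 1 l 0 / real q ^ l)) / real q ^ r)
    = (\<lambda>l. real (l + r) * H 1 (l + r))"
    by (simp add: H_shift fun_eq_iff algebra_simps add_divide_distrib)
  finally show "(\<lambda>j. real j * H 1 j) sums ((B_tx q r f / real q + real r * B_t q r f) / real q ^ r)"
    by (rule shift) (use H_small[of 1] in simp)
qed

end

section \<open>The renewal structure\<close>

text \<open>Exchanging the sums counts \<open>a j\<close> once for each \<open>k < j + r\<close>,
  hence \<open>j + r\<close> times. The shift by \<open>r\<close> is the delay after which
  \<open>u\<close> is constant.\<close>

lemma summable_tail_sums:
  fixes a :: "nat \<Rightarrow> real"
  assumes "\<And>j. a j \<ge> 0" "summable a" "summable (\<lambda>j. real j * a j)"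
  shows "summable (\<lambda>k. \<Sum>j. if k < j + r then a j else 0)"
proof (rule bounded_imp_summable)
  have sm: "summable (\<lambda>j. if k < j + r then a j else 0)" for k
    using assms(2) by (rule summable_comparison_test') (use assms(1) in auto)
  show "(\<Sum>j. if k < j + r then a j else 0) \<ge> 0" for k
    using sm assms(1) by (intro suminf_nonneg) auto
  show "(\<Sum>k\<le>N. \<Sum>j. if k < j + r then a j else 0) \<le> (\<Sum>j. real j * a j + real r * a j)" for N
  proof -
    have "(\<Sum>k\<le>N. \<Sum>j. if k < j + r then a j else 0) = (\<Sum>j. \<Sum>k\<le>N. if k < j + r then a j else 0)"
      by (intro suminf_sum[symmetric] sm)
    also have "\<dots> \<le> (\<Sum>j. real j * a j + real r * a j)"
    proof (rule suminf_le)
      fix j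
      have "(\<Sum>k\<le>N. if k < j + r then a j else 0) = real (card {k\<in>{..N}. k < j + r}) * a j"
        by (simp add: sum.If_cases Int_def)
      also have "card {k\<in>{..N}. k < j + r} \<le> card {..<j + r}" by (intro card_mono) auto
      then have "real (card {k\<in>{..N}. k < j + r}) * a j \<le> real (j + r) * a j"
        using assms(1) by (intro mult_right_mono) auto
      finally show "(\<Sum>k\<le>N. if k < j + r then a j else 0) \<le> real j * a j + real r * a j"
        by (simp add: algebra_simps)
    qed (use assms(2,3) in \<open>auto intro!: summable_sum sm summable_add summable_mult\<close>)
    finally show ?thesis .
  qed
qed

text \<open>The algebra behind the closed form of sigma^2, with X = q^r, w = q^(-r), d = 1/(q-1),
  and B, C, T standing for B_t, B_tt, B_tx/q. The left side is the second moment of the centred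
  reward with mu = B w^2. Treating reciprocals as variables with polynomial relations makes it an
  ideal membership question.\<close>

lemma variance_identity:
  fixes w X d q B T C r :: real
  assumes w: "X * w = 1" and d: "q * d - d = 1"
  shows "C * w - 2 * (B * w ^ 2) * ((T + r * B) * w) + (B * w ^ 2)\<^sup>2 * (X - 2 * X\<^sup>2 * (r * w - (q - q * w) * d))
    = (- B\<^sup>2 * (q * w ^ 4) * d + 2 * B\<^sup>2 * (q * w ^ 3) * d - B\<^sup>2 * w ^ 4 * d - 4 * r * B\<^sup>2 * w ^ 4 + C * w ^ 2 - 2 * B * (T * w ^ 4)) * X"
proof -
  have e: "w ^ 4 * X = w ^ 3" "w ^ 3 * X = w ^ 2" "w ^ 2 * X = w" "(w\<^sup>2)\<^sup>2 * X\<^sup>2 = w\<^sup>2" "(w\<^sup>2)\<^sup>2 * X = w ^ 3"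
    using w by algebra+
  have "C * w - 2 * (B * w ^ 2) * ((T + r * B) * w) + (B * w ^ 2)\<^sup>2 * (X - 2 * X\<^sup>2 * (r * w - (q - q * w) * d))
    = C * w - 2 * B * (T + r * B) * w ^ 3 + B\<^sup>2 * ((w\<^sup>2)\<^sup>2 * X) - 2 * B\<^sup>2 * ((w\<^sup>2)\<^sup>2 * X\<^sup>2) * (r * w - (q - q * w) * d)"
    by algebra
  also have "\<dots> = C * w - 2 * B * (T + r * B) * w ^ 3 + B\<^sup>2 * w ^ 3 - 2 * B\<^sup>2 * w\<^sup>2 * (r * w - (q - q * w) * d)"
    by (simp only: e)
  also have "\<dots> = - B\<^sup>2 * (q * w ^ 3) * d + 2 * B\<^sup>2 * (q * w ^ 2) * d - B\<^sup>2 * w ^ 3 * d - 4 * r * B\<^sup>2 * w ^ 3 + C * w - 2 * B * (T * w ^ 3)"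
    using d by algebra
  also have "\<dots> = - B\<^sup>2 * (q * (w ^ 4 * X)) * d + 2 * B\<^sup>2 * (q * (w ^ 3 * X)) * d - B\<^sup>2 * (w ^ 4 * X) * d
    - 4 * r * B\<^sup>2 * (w ^ 4 * X) + C * (w\<^sup>2 * X) - 2 * B * (T * (w ^ 4 * X))"
    by (simp only: e)
  also have "\<dots> = (- B\<^sup>2 * (q * w ^ 4) * d + 2 * B\<^sup>2 * (q * w ^ 3) * d - B\<^sup>2 * w ^ 4 * d - 4 * r * B\<^sup>2 * w ^ 4 + C * w ^ 2 - 2 * B * (T * w ^ 4)) * X"
    by algebra
  finally show ?thesis .
qed
context positive_quasimultiplicative
begin

abbreviation \<mu> :: real where "\<mu> \<equiv> mean_const q r f"

text \<open>In probabilistic terms \<open>p\<close> is the law of the cycle length,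
  \<open>u k\<close> the probability of a renewal at \<open>k\<close>, and \<open>y i j\<close> the
  i-th moment of the centred reward on the event that the cycle has length \<open>j\<close>.\<close>

definition p :: "nat \<Rightarrow> real" where "p j = real (card (cycles q r j)) / real q ^ j"

definition u :: "nat \<Rightarrow> real" where "u k = 1 / real q ^ min k r"

definition y :: "nat \<Rightarrow> nat \<Rightarrow> real" where
  "y i j = (\<Sum>b\<in>cycles q r j. (h b - \<mu> * real j) ^ i) / real q ^ j"

text \<open>The expectation of \<open>G (h - \<mu> * k)\<close> over all words of length \<open>k\<close>, restricted to the event that
  the word is a concatenation of cycles: a word of length \<open>k - r\<close> followed by \<open>r\<close> zeros, or, for
  \<open>k < r\<close>, the zero word.\<close>

definition R :: "(real \<Rightarrow> 'a::real_normed_field) \<Rightarrow> nat \<Rightarrow> 'a" where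
  "R G k = (\<Sum>n<q ^ (k - r). G (h n - \<mu> * real k)) / of_nat q ^ k"

text \<open>Conditioning on the first cycle. The logarithm and the centring term are both additive
  along the decomposition, so that cycle acts on the rest only by shifting the argument of
  \<open>G\<close>.\<close>

lemma R_rec:
  assumes "k \<ge> 1"
  shows "R G k = (\<Sum>j=1..k. (\<Sum>b\<in>cycles q r j. R (\<lambda>x. G (x + (h b - \<mu> * real j))) (k - j)) / of_nat q ^ j)"
proof -
  have "(\<Sum>n<q ^ (k - r). G (h n - \<mu> * real k)) =
    (\<Sum>j=1..k. \<Sum>b\<in>cycles q r j. \<Sum>a<q ^ (k - j - r). G (h (q ^ j * a + b) - \<mu> * real k))"
    by (rule sum_cycle_decomposition[OF q assms])
  also have "\<dots> = (\<Sum>j=1..k. \<Sum>b\<in>cycles q r j. \<Sum>a<q ^ (k - j - r).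
      G (h a - \<mu> * real (k - j) + (h b - \<mu> * real j)))"
    by (intro sum.cong refl arg_cong[of _ _ G]) (simp add: h_cycle of_nat_diff right_diff_distrib)
  finally have "R G k = (\<Sum>j=1..k. (\<Sum>b\<in>cycles q r j. \<Sum>a<q ^ (k - j - r).
      G (h a - \<mu> * real (k - j) + (h b - \<mu> * real j))) / of_nat q ^ k)"
    by (simp add: R_def sum_divide_distrib)
  also have "\<dots> = (\<Sum>j=1..k. (\<Sum>b\<in>cycles q r j. R (\<lambda>x. G (x + (h b - \<mu> * real j))) (k - j)) / of_nat q ^ j)"
  proof (rule sum.cong[OF refl])
    fix j assume "j \<in> {1..k}"
    then have "(of_nat q :: 'a) ^ k = of_nat q ^ (k - j) * of_nat q ^ j" by (simp flip: power_add)
    then show "(\<Sum>b\<in>cycles q r j. \<Sum>a<q ^ (k - j - r). G (h a - \<mu> * real (k - j) + (h b - \<mu> * real j))) / of_nat q ^ k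
      = (\<Sum>b\<in>cycles q r j. R (\<lambda>x. G (x + (h b - \<mu> * real j))) (k - j)) / of_nat q ^ j"
      by (simp add: R_def flip: sum_divide_distrib)
  qed
  finally show ?thesis .
qed

lemma cycles_0: "cycles q r 0 = {}"
  using cycles_pos[OF q, of _ r 0] by auto

lemma y_0 [simp]: "y i 0 = 0" and p_0 [simp]: "p 0 = 0"
  by (simp_all add: y_def p_def cycles_0)

lemma R_0: "R G 0 = G 0"
  by (simp add: R_def)

lemma R_1: "R (\<lambda>_. 1) k = u k"
proof (cases "k \<le> r")
  case False
  then have "real q ^ k = real q ^ (k - r) * real q ^ r" by (simp flip: power_add)
  then show ?thesis using False q by (simp add: R_def u_def min_def)
qed (simp add: R_def u_def min_def)

lemma R_rec_0:
  assumes "k \<ge> 1"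
  shows "R G k = (\<Sum>j=0..k. (\<Sum>b\<in>cycles q r j. R (\<lambda>x. G (x + (h b - \<mu> * real j))) (k - j)) / of_nat q ^ j)"
  using R_rec[OF assms, of G] by (simp add: sum.atLeast_Suc_atMost[of 0] cycles_0)

section \<open>Generating functions of the renewal process\<close>

definition U :: "real fps" where "U = Abs_fps u"
definition P :: "real fps" where "P = Abs_fps p"
definition Y :: "nat \<Rightarrow> real fps" where "Y i = Abs_fps (y i)"
definition M :: "nat \<Rightarrow> real fps" where "M i = Abs_fps (R (\<lambda>x. x ^ i))"

lemma renewal_equation: "U * (1 - P) = 1"
proof -
  have "U = 1 + P * U"
  proof (rule fps_ext)
    fix k show "fps_nth U k = fps_nth (1 + P * U) k"
    proof (cases "k = 0")
      case False
      have "u k = (\<Sum>j=0..k. p j * u (k - j))"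
        using R_rec_0[of k "\<lambda>_. 1 :: real"] False by (simp add: R_1 p_def)
      then show ?thesis using False by (simp add: U_def P_def fps_mult_nth)
    qed (simp add: U_def P_def u_def)
  qed
  then show ?thesis by (simp add: algebra_simps)
qed

lemma fps_solve_renewal:
  assumes "A = P * A + B" shows "A = U * B"
proof -
  have "A = U * (1 - P) * A" by (simp add: renewal_equation)
  also have "\<dots> = U * (A - P * A)" by (simp add: algebra_simps)
  also have "A - P * A = B" using assms by (simp add: algebra_simps)
  finally show ?thesis .
qed

text \<open>Under a shift \<open>x + c\<close> the term \<open>x\<close> reproduces the kernel
  \<open>P\<close> and the term \<open>c\<close> multiplies a renewal probability. Solving means
  multiplying by \<open>U\<close>, the inverse of \<open>1 - P\<close>.\<close>

lemma first_moment_eq: "M 1 = U * (Y 1 * U)"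
proof (rule fps_solve_renewal, rule fps_ext)
  fix k show "fps_nth (M 1) k = fps_nth (P * M 1 + Y 1 * U) k"
  proof (cases "k = 0")
    case False
    have "R (\<lambda>x. x + c) m = R (\<lambda>x. x) m + c * u m" for c m
      by (simp add: R_def sum.distrib add_divide_distrib flip: R_1)
    then have "R (\<lambda>x. x) k = (\<Sum>j=0..k. p j * R (\<lambda>x. x) (k - j) + y 1 j * u (k - j))"
      using R_rec_0[of k "\<lambda>x. x :: real"] False
      by (simp add: sum.distrib p_def y_def add_divide_distrib sum_distrib_right)
    then show ?thesis by (simp add: M_def U_def P_def Y_def fps_mult_nth sum.distrib)
  qed (simp add: M_def U_def P_def Y_def R_0)
qed

lemma second_moment_eq: "M 2 = U * (Y 1 * M 1 + Y 1 * M 1 + Y 2 * U)"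
proof (rule fps_solve_renewal, rule fps_ext)
  fix k show "fps_nth (M 2) k = fps_nth (P * M 2 + (Y 1 * M 1 + Y 1 * M 1 + Y 2 * U)) k"
  proof (cases "k = 0")
    case False
    have "R (\<lambda>x. (x + c)\<^sup>2) m = R (\<lambda>x. x\<^sup>2) m + (c * R (\<lambda>x. x) m + c * R (\<lambda>x. x) m) + c\<^sup>2 * u m" for c m
      by (simp add: R_def power2_sum sum.distrib add_divide_distrib sum_distrib_left sum_divide_distrib
            mult_ac flip: R_1)
    note expand = this
    have "(\<Sum>b\<in>cycles q r j. R (\<lambda>x. (x + (h b - \<mu> * real j))\<^sup>2) (k - j)) / real q ^ j =
        p j * R (\<lambda>x. x\<^sup>2) (k - j) + (y 1 j * R (\<lambda>x. x) (k - j) + y 1 j * R (\<lambda>x. x) (k - j) + y 2 j * u (k - j))" for j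
      unfolding expand sum.distrib sum_distrib_right[symmetric]
      by (simp add: p_def y_def add_divide_distrib)
    then have "R (\<lambda>x. x\<^sup>2) k = (\<Sum>j=0..k. p j * R (\<lambda>x. x\<^sup>2) (k - j) +
        (y 1 j * R (\<lambda>x. x) (k - j) + y 1 j * R (\<lambda>x. x) (k - j) + y 2 j * u (k - j)))"
      using R_rec_0[of k "\<lambda>x. (x :: real)\<^sup>2"] False by simp
    then show ?thesis
      by (simp only: M_def U_def P_def Y_def fps_add_nth fps_mult_nth fps_nth_Abs_fps sum.distrib power_one_right)
  qed (simp add: M_def U_def P_def Y_def R_0)
qed

lemma p_nonneg: "p j \<ge> 0"
  by (simp add: p_def)

lemma p_le: obtains C \<theta> where "C > 0" "0 < \<theta>" "\<theta> < 1" "\<And>j. p j \<le> C * \<theta> ^ j"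
proof -
  obtain C \<theta> where "C > 0" "0 < \<theta>" "\<theta> < 1"
    "\<And>j. real (card (cycles q r j)) \<le> C * \<theta> ^ j * real q ^ j"
    using card_cycles_le[OF q, of r] by blast
  then show thesis using that[of C \<theta>] q by (simp add: p_def field_simps)
qed

lemma summable_p: "summable (\<lambda>j. real j ^ i * p j)"
proof -
  obtain C \<theta> where C: "C > 0" "0 < \<theta>" "\<theta> < 1" "\<And>j. p j \<le> C * \<theta> ^ j" using p_le by blast
  have "summable (\<lambda>j. C * (real j ^ i * \<theta> ^ j))"
    using C by (intro summable_mult summable_power_times_geometric) auto
  then show ?thesis
  proof (rule summable_comparison_test')
    show "norm (real j ^ i * p j) \<le> C * (real j ^ i * \<theta> ^ j)" for j
      using mult_left_mono[OF C(4)[of j], of "real j ^ i"] by (simp add: p_nonneg mult_ac)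
  qed
qed

lemma fps_conv_radius_P: "fps_conv_radius P > 1"
proof -
  obtain C \<theta> where C: "C > 0" "0 < \<theta>" "\<theta> < 1" "\<And>j. p j \<le> C * \<theta> ^ j" using p_le by blast
  \<comment> \<open>A radius between 1 and \<open>1 / \<theta>\<close>, which leaves the convergent
    majorant \<open>sqrt \<theta> ^ j\<close>.\<close>
  define z where "z = 1 / sqrt \<theta>"
  have z: "z > 1" "\<theta> * z = sqrt \<theta>"
    using C by (auto simp: z_def field_simps)
  have "summable (\<lambda>j. C * sqrt \<theta> ^ j)"
    using C by (intro summable_mult summable_geometric) auto
  then have "summable (\<lambda>j. p j * z ^ j)"
  proof (rule summable_comparison_test')
    show "norm (p j * z ^ j) \<le> C * sqrt \<theta> ^ j" for j
      using mult_right_mono[OF C(4)[of j], of "z ^ j"] z p_nonneg[of j]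
      by (simp add: z(2)[symmetric] power_mult_distrib mult_ac)
  qed
  then have "conv_radius p \<ge> norm z" by (rule conv_radius_geI)
  then have "1 < norm z \<and> norm z \<le> fps_conv_radius P" using z by (simp add: fps_conv_radius_def P_def)
  then show ?thesis by (metis less_le_trans ereal_less(2) less_ereal.simps(1) one_ereal_def)
qed

text \<open>The increments of \<open>u\<close>. It is a polynomial, and it equals
  \<open>(1 - fps_X) / (1 - P)\<close>: the common zero at 1 has been cancelled, so the identity can
  be evaluated and differentiated there.\<close>

definition V :: "real fps" where "V = U * (1 - fps_X)"

lemma V_nth: "fps_nth V k = u k - (if k = 0 then 0 else u (k - 1))"
  by (simp add: V_def U_def algebra_simps)

lemma V_nth_0: "k > r \<Longrightarrow> fps_nth V k = 0"
  by (cases "k - 1 = r") (auto simp: V_nth u_def min_def)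

lemma V_renewal: "V * (1 - P) = 1 - fps_X"
proof -
  have "V * (1 - P) = (U * (1 - P)) * (1 - fps_X)" by (simp only: V_def mult_ac)
  then show ?thesis by (simp add: renewal_equation)
qed

lemma sum_V: "(\<Sum>k\<le>n. fps_nth V k) = u n"
  by (induction n) (auto simp: V_nth u_def)

lemma suminf_V: "(\<Sum>k. fps_nth V k * g k) = (\<Sum>k\<le>r. fps_nth V k * g k)"
  by (rule suminf_finite) (auto simp: V_nth_0)

text \<open>Summation by parts; at \<open>n = r\<close> it evaluates the derivative of
  \<open>V\<close> at 1.\<close>

lemma sum_V_index: "(\<Sum>k\<le>n. fps_nth V k * real k) = real n * u n - (\<Sum>k<n. u k)"
  by (induction n) (auto simp: V_nth algebra_simps)

lemma fps_conv_radius_V: "fps_conv_radius V = \<infinity>"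
proof -
  have "fps_conv_radius V \<ge> ereal R" for R
  proof -
    have "summable (\<lambda>k. fps_nth V k * (max 0 R) ^ k)"
      by (rule summable_finite[of "{..r}"]) (auto simp: V_nth_0)
    then have "conv_radius (fps_nth V) \<ge> norm (max 0 R)" by (rule conv_radius_geI)
    then show ?thesis unfolding fps_conv_radius_def
      by (metis abs_of_nonneg ereal_less_eq(3) max.cobounded1 max.cobounded2 order_trans real_norm_def)
  qed
  then show ?thesis by (metis ereal_top)
qed

text \<open>The identity \<open>V_renewal\<close> and its first two derivatives are evaluated at 1,
  which lies inside the disc of convergence of \<open>P\<close>. With V(1) = q^(-r) this gives P(1)
  = 1, V(1) P'(1) = 1 and V(1) P''(1) = -2 V'(1) P'(1).\<close>

lemma renewal_sums:
  shows "p sums 1"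
    and "(\<lambda>j. real j * p j) sums (real q ^ r)"
    and "(\<lambda>j. real j ^ 2 * p j) sums (real q ^ r - 2 * real q ^ (2 * r) * (\<Sum>k\<le>r. fps_nth V k * real k))"
proof -
  have q0: "real q ^ r > 0" using q by simp
  have rad: "norm (1::real) < fps_conv_radius P" "norm (1::real) < fps_conv_radius (fps_deriv P)"
    "norm (1::real) < fps_conv_radius (fps_deriv (fps_deriv P))"
    using fps_conv_radius_P fps_conv_radius_deriv[of P] fps_conv_radius_deriv[of "fps_deriv P"]
    by (auto simp: one_ereal_def)
  have radV: "norm (1::real) < fps_conv_radius V" "norm (1::real) < fps_conv_radius (fps_deriv V)"
    "norm (1::real) < fps_conv_radius (fps_deriv (fps_deriv V))"
    using fps_conv_radius_V fps_conv_radius_deriv[of V] fps_conv_radius_deriv[of "fps_deriv V"]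
    by auto
  have rad1: "norm (1::real) < fps_conv_radius (1 - P)"
    using fps_conv_radius_diff[of 1 P] rad(1) by (auto simp: min_def split: if_splits)
  define e where "e A = eval_fps A (1::real)" for A
  have eV: "e V = 1 / real q ^ r"
    using suminf_V[of "\<lambda>_. 1"] sum_V[of r] by (simp add: e_def eval_fps_def u_def)
  have mult: "e (A * B) = e A * e B"
    if "norm (1::real) < fps_conv_radius A" "norm (1::real) < fps_conv_radius B" for A B
    unfolding e_def by (rule eval_fps_mult[OF that])
  have "e (V * (1 - P)) = 0"
    unfolding V_renewal by (simp add: e_def eval_fps_diff)
  then have 1: "e (1 - P) = 0" using mult[OF radV(1) rad1] eV q0 by auto
  then have eP: "e P = 1" using rad(1) by (simp add: e_def eval_fps_diff)
  have d1: "V * fps_deriv P = 1 + fps_deriv V * (1 - P)"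
    using arg_cong[OF V_renewal, of fps_deriv] by (simp add: algebra_simps)
  have rad2: "norm (1::real) < fps_conv_radius (A * B)"
    if "norm (1::real) < fps_conv_radius A" "norm (1::real) < fps_conv_radius B" for A B
    using fps_conv_radius_mult[of A B] that by (auto simp: min_def split: if_splits)
  have "e (V * fps_deriv P) = 1"
    unfolding d1 using rad2[OF radV(2) rad1] mult[OF radV(2) rad1] 1
    by (simp add: e_def eval_fps_add)
  then have eP': "e (fps_deriv P) = real q ^ r"
    using mult[OF radV(1) rad(2)] eV q0 by (simp add: field_simps)
  have d2: "V * fps_deriv (fps_deriv P) + 2 * (fps_deriv V * fps_deriv P) = fps_deriv (fps_deriv V) * (1 - P)"
    using arg_cong[OF d1, of fps_deriv] by (simp add: algebra_simps)
  have "e (V * fps_deriv (fps_deriv P) + 2 * (fps_deriv V * fps_deriv P)) = 0"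
    unfolding d2 using mult[OF radV(3) rad1] 1 by simp
  moreover have "e (V * fps_deriv (fps_deriv P) + 2 * (fps_deriv V * fps_deriv P)) =
     e V * e (fps_deriv (fps_deriv P)) + 2 * (e (fps_deriv V) * e (fps_deriv P))"
    using rad2[OF radV(1) rad(3)] rad2[OF radV(2) rad(2)] rad2[of 2 "fps_deriv V * fps_deriv P"]
      mult[OF radV(1) rad(3)] mult[OF radV(2) rad(2)] mult[of 2 "fps_deriv V * fps_deriv P"]
    by (simp add: e_def eval_fps_add)
  ultimately have "e (fps_deriv (fps_deriv P)) / real q ^ r = - 2 * real q ^ r * e (fps_deriv V)"
    unfolding eV eP' by (simp add: mult_ac)
  moreover have "e (fps_deriv (fps_deriv P)) = e (fps_deriv (fps_deriv P)) / real q ^ r * real q ^ r"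
    using q0 by (metis nonzero_eq_divide_eq less_irrefl)
  moreover have "real q ^ (2 * r) = real q ^ r * real q ^ r"
    by (simp only: mult_2 power_add)
  ultimately have eP'': "e (fps_deriv (fps_deriv P)) = - 2 * real q ^ (2 * r) * e (fps_deriv V)"
    by (simp only: mult_ac)
  have e1: "(\<lambda>k. real k * fps_nth A k) sums e (fps_deriv A)"
    if "norm (1::real) < fps_conv_radius (fps_deriv A)" for A
  proof -
    have "(\<lambda>k. real (Suc k) * fps_nth A (Suc k)) sums e (fps_deriv A)"
      using sums_eval_fps[OF that] by (simp add: e_def)
    then show ?thesis by (subst (asm) sums_Suc_iff) simp
  qed
  show "p sums 1" using sums_eval_fps[OF rad(1)] eP by (simp add: e_def P_def)
  show s1: "(\<lambda>j. real j * p j) sums (real q ^ r)" using e1[OF rad(2)] eP' by (simp add: P_def)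
  \<comment> \<open>The second derivative gives the factorial moment of k(k-1); adding the mean
    turns it into the moment of k^2.\<close>
  have "(\<lambda>k. real k * (real (Suc k) * fps_nth P (Suc k))) sums e (fps_deriv (fps_deriv P))"
    using e1[OF rad(3)] by simp
  then have "(\<lambda>k. real (k - 1) * (real k * p k)) sums e (fps_deriv (fps_deriv P))"
    using sums_Suc_iff[of "\<lambda>k. real (k - 1) * (real k * p k)"] by (simp add: P_def)
  then have "(\<lambda>k. real (k - 1) * (real k * p k) + real k * p k) sums
      (e (fps_deriv (fps_deriv P)) + real q ^ r)"
    by (rule sums_add[OF _ s1])
  also have "(\<lambda>k. real (k - 1) * (real k * p k) + real k * p k) = (\<lambda>k. real k ^ 2 * p k)"
  proof
    show "real (k - 1) * (real k * p k) + real k * p k = real k ^ 2 * p k" for k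
      by (cases k) (auto simp: power2_eq_square algebra_simps)
  qed
  finally have s2: "(\<lambda>k. real k ^ 2 * p k) sums (e (fps_deriv (fps_deriv P)) + real q ^ r)" .
  have "(\<lambda>k. fps_nth V k * real k) sums e (fps_deriv V)"
    using e1[OF radV(2)] by (simp add: mult.commute)
  then have "e (fps_deriv V) = (\<Sum>k\<le>r. fps_nth V k * real k)"
    using suminf_V[of real] by (simp add: sums_iff)
  then show "(\<lambda>j. real j ^ 2 * p j) sums (real q ^ r - 2 * real q ^ (2 * r) * (\<Sum>k\<le>r. fps_nth V k * real k))"
    using s2 eP'' by simp
qed

section \<open>Moments of the centred cycle reward\<close>

definition L :: real where "L = hK + \<bar>\<mu>\<bar>"

lemma L_nonneg: "L \<ge> 0"
  using hK_nonneg by (simp add: L_def)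

lemma cycle_reward_le: "b \<in> cycles q r j \<Longrightarrow> \<bar>h b - \<mu> * real j\<bar> \<le> L * real j"
  using abs_h_cycle[of b j] abs_triangle_ineq4[of "h b" "\<mu> * real j"]
  by (simp add: L_def abs_mult algebra_simps)

lemma abs_y_le: "\<bar>y i j\<bar> \<le> L ^ i * (real j ^ i * p j)"
proof -
  have "\<bar>\<Sum>b\<in>cycles q r j. (h b - \<mu> * real j) ^ i\<bar> \<le> (\<Sum>b\<in>cycles q r j. (L * real j) ^ i)"
    by (intro sum_norm_le[where 'b = real, simplified] order_trans[OF sum_abs] sum_mono)
       (auto simp: power_abs intro!: power_mono cycle_reward_le)
  also have "\<dots> = L ^ i * real j ^ i * real (card (cycles q r j))"
    by (simp add: power_mult_distrib)
  finally show ?thesis using q by (simp add: y_def p_def abs_mult divide_right_mono)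
qed

lemma summable_y: "summable (\<lambda>j. real j ^ m * \<bar>y i j\<bar>)"
proof -
  have "summable (\<lambda>j. L ^ i * (real j ^ (m + i) * p j))" by (intro summable_mult summable_p)
  then show ?thesis
  proof (rule summable_comparison_test')
    show "norm (real j ^ m * \<bar>y i j\<bar>) \<le> L ^ i * (real j ^ (m + i) * p j)" for j
      using mult_left_mono[OF abs_y_le[of i j], of "real j ^ m"] by (simp add: power_add mult_ac)
  qed
qed

lemma summable_y_0: "summable (\<lambda>j. \<bar>y i j\<bar>)" "summable (y i)"
  using summable_y[of 0 i] summable_rabs_cancel by auto

text \<open>The origin of mu: a cycle has mean reward B_t / q^r and mean length q^r, and mu is their
  quotient.\<close>

lemma y1_sums: "y 1 sums 0"
proof -
  have "y 1 = (\<lambda>j. H 1 j - \<mu> * (real j * p j))"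
    by (auto simp: y_def H_def p_def sum_subtractf diff_divide_distrib)
  moreover have "(\<lambda>j. H 1 j - \<mu> * (real j * p j)) sums (B_t q r f / real q ^ r - \<mu> * real q ^ r)"
    by (intro sums_diff sums_mult H_sums renewal_sums)
  moreover have "B_t q r f / real q ^ r - \<mu> * real q ^ r = 0"
    using q by (simp add: mean_const_def power_mult power2_eq_square field_simps)
  ultimately show ?thesis by simp
qed

lemma sum_u_less_r: "(\<Sum>k<r. u k) * (real q - 1) = real q - real q / real q ^ r"
proof -
  have "(\<Sum>k<r. u k) = (\<Sum>k<r. (1 / real q) ^ k)" by (auto simp: u_def power_divide)
  also have "\<dots> = (1 - (1 / real q) ^ r) / (1 - 1 / real q)"
    using q by (subst sum_gp_strict) auto
  finally show ?thesis using q by (simp add: power_divide field_simps)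
qed

text \<open>Expanding the square needs the moments of reward, of length times reward, and of squared
  length. The last one involves V'(1), a geometric sum, which brings in the factors 1/(q-1).\<close>

lemma y2_sums: "y 2 sums (var_const q r f * real q ^ r)"
proof -
  define S where "S = (\<Sum>k\<le>r. fps_nth V k * real k)"
  define s where "s = (\<Sum>k<r. u k)"
  define X where "X = real q ^ r"
  have X: "X > 0" using q by (simp add: X_def)
  have S: "S = real r / X - s" using sum_V_index[of r] by (simp add: S_def s_def u_def X_def)
  have s: "s = (real q - real q / X) / (real q - 1)"
    using sum_u_less_r q by (simp add: s_def X_def field_simps)
  have "y 2 = (\<lambda>j. H 2 j - 2 * \<mu> * (real j * H 1 j) + \<mu>\<^sup>2 * (real j ^ 2 * p j))"
    by (auto simp: y_def H_def p_def sum_subtractf sum.distrib power2_diff diff_divide_distrib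
        add_divide_distrib sum_distrib_left power_mult_distrib mult_ac)
  moreover have "(\<lambda>j. H 2 j - 2 * \<mu> * (real j * H 1 j) + \<mu>\<^sup>2 * (real j ^ 2 * p j)) sums
    (B_tt q r f / real q ^ r - 2 * \<mu> * ((B_tx q r f / real q + real r * B_t q r f) / real q ^ r)
      + \<mu>\<^sup>2 * (real q ^ r - 2 * real q ^ (2 * r) * S))"
    unfolding S_def by (intro sums_diff sums_add sums_mult H_sums renewal_sums)
  moreover have "B_tt q r f / real q ^ r - 2 * \<mu> * ((B_tx q r f / real q + real r * B_t q r f) / real q ^ r)
      + \<mu>\<^sup>2 * (real q ^ r - 2 * real q ^ (2 * r) * S) = var_const q r f * real q ^ r"
  proof -
    have pw: "real q powi (- 4 * int r + 1) = real q / X ^ 4" "real q powi (- 3 * int r + 1) = real q / X ^ 3"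
      "real q powi (- 4 * int r) = 1 / X ^ 4" "real q powi (- 2 * int r) = 1 / X ^ 2"
      "real q powi (- 4 * int r - 1) = 1 / (real q * X ^ 4)" "(real q - 1) powi - 1 = 1 / (real q - 1)"
      "real q ^ (2 * r) = X ^ 2"
      using q by (auto simp: X_def power_int_add power_int_diff power_int_minus power_int_mult
          divide_simps power_mult[symmetric] mult.commute)
    define w where "w = 1 / X"
    define d where "d = 1 / (real q - 1)"
    define T where "T = B_tx q r f / real q"
    have w: "X * w = 1" and d: "real q * d - d = 1"
      using X q by (auto simp: w_def d_def simp flip: diff_divide_distrib)
    have T: "B_tx q r f * (1 / (real q * X ^ 4)) = T * w ^ 4" by (simp add: T_def w_def power_divide)
    have "var_const q r f = - (B_t q r f)\<^sup>2 * (real q * w ^ 4) * d + 2 * (B_t q r f)\<^sup>2 * (real q * w ^ 3) * d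
        - (B_t q r f)\<^sup>2 * w ^ 4 * d - 4 * real r * (B_t q r f)\<^sup>2 * w ^ 4 + B_tt q r f * w ^ 2
        - 2 * B_t q r f * (T * w ^ 4)"
      unfolding var_const_def pw T[symmetric] by (simp add: w_def d_def power_divide)
    moreover have "\<mu> = B_t q r f * w ^ 2" unfolding mean_const_def pw by (simp add: w_def power_divide)
    moreover have "S = real r * w - (real q - real q * w) * d" by (simp add: S s w_def d_def)
    ultimately have "B_tt q r f * w - 2 * \<mu> * ((T + real r * B_t q r f) * w) + \<mu>\<^sup>2 * (X - 2 * X\<^sup>2 * S)
        = var_const q r f * X"
      by (simp only: variance_identity[OF w d])
    then show ?thesis unfolding pw X_def[symmetric] by (simp add: w_def T_def)
  qed
  ultimately show ?thesis by simp
qed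

end

section \<open>Mean and variance\<close>

lemma expectation_unif_pmf:
  fixes g :: "nat \<Rightarrow> 'a :: {banach, second_countable_topology}"
  assumes "q > 0"
  shows "measure_pmf.expectation (unif_pmf q k) g = (\<Sum>n<q ^ k. g n) /\<^sub>R real q ^ k"
proof -
  have ne: "{0..<q ^ k} \<noteq> {}" using assms by simp
  have "measure_pmf.expectation (unif_pmf q k) g = (\<Sum>n\<in>{0..<q ^ k}. pmf (unif_pmf q k) n *\<^sub>R g n)"
    unfolding unif_pmf_def using set_pmf_of_set[OF ne] by (intro integral_measure_pmf) auto
  also have "\<dots> = (\<Sum>n<q ^ k. (1 / real q ^ k) *\<^sub>R g n)"
    unfolding unif_pmf_def using ne by (intro sum.cong) (auto simp: pmf_of_set)
  finally show ?thesis by (simp add: scaleR_sum_right divide_inverse)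
qed

text \<open>It allows the variance to be computed around an explicit centre \<open>c\<close> in
  place of the true mean, at the price of the squared mean of \<open>g - c\<close>.\<close>

lemma mean_square_deviation:
  fixes g :: "'b \<Rightarrow> real"
  assumes "finite A" "A \<noteq> {}"
  defines "N \<equiv> real (card A)"
  shows "(\<Sum>n\<in>A. (g n - (\<Sum>n\<in>A. g n) / N)\<^sup>2) / N = (\<Sum>n\<in>A. (g n - c)\<^sup>2) / N - ((\<Sum>n\<in>A. g n - c) / N)\<^sup>2"
proof -
  define m where "m = (\<Sum>n\<in>A. g n) / N"
  have N: "N > 0" using assms by (simp add: card_gt_0_iff)
  have S: "(\<Sum>n\<in>A. g n) = N * m" using N by (simp add: m_def)
  have sq: "(\<Sum>n\<in>A. (g n - a)\<^sup>2) = (\<Sum>n\<in>A. (g n)\<^sup>2) - 2 * a * (N * m) + N * a\<^sup>2" for a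
  proof -
    have "(g n - a)\<^sup>2 = (g n)\<^sup>2 - 2 * a * g n + a\<^sup>2" for n by (simp add: power2_diff)
    then have "(\<Sum>n\<in>A. (g n - a)\<^sup>2) = (\<Sum>n\<in>A. (g n)\<^sup>2) - 2 * a * (\<Sum>n\<in>A. g n) + N * a\<^sup>2"
      by (simp only: sum.distrib sum_subtractf sum_distrib_left[symmetric] sum_constant N_def)
    then show ?thesis by (simp only: S)
  qed
  have dev: "(\<Sum>n\<in>A. g n - c) / N = m - c"
    using N by (simp add: sum_subtractf S N_def[symmetric] diff_divide_distrib)
  show ?thesis unfolding m_def[symmetric] sq dev using N
    by (simp add: power2_eq_square field_simps)
qed

context positive_quasimultiplicative
begin

lemma u_nonneg: "u k \<ge> 0" and u_le_1: "u k \<le> 1"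
  using q by (auto simp: u_def)

lemma u_eq: "r \<le> k \<Longrightarrow> u k = u r"
  by (simp add: u_def min_def)

text \<open>As \<open>y 1\<close> sums to 0, the constant \<open>u r\<close> may be subtracted from
  the weights \<open>u (k - j)\<close>. The difference vanishes for \<open>j + r \<le> k\<close>, so
  only the tail of \<open>y 1\<close> survives.\<close>

lemma abs_U_Y1_le: "\<bar>fps_nth (U * Y 1) k\<bar> \<le> (\<Sum>j. if k < j + r then \<bar>y 1 j\<bar> else 0)"
proof -
  define w where "w j = (if j \<in> {0..k} then u (k - j) else 0) - u r" for j
  have w: "\<bar>w j * y 1 j\<bar> \<le> (if k < j + r then \<bar>y 1 j\<bar> else 0)" for j
  proof (cases "k < j + r")
    case True
    have "\<bar>w j\<bar> \<le> 1" using u_nonneg[of "k - j"] u_nonneg[of r] u_le_1[of "k - j"] u_le_1[of r]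
      by (auto simp: w_def)
    then show ?thesis using True mult_right_mono[of "\<bar>w j\<bar>" 1 "\<bar>y 1 j\<bar>"] by (simp add: abs_mult)
  next
    case False
    then have "w j = 0" using u_eq[of "k - j"] by (auto simp: w_def)
    then show ?thesis using False by simp
  qed
  have sm: "summable (\<lambda>j. if k < j + r then \<bar>y 1 j\<bar> else 0)"
    by (rule summable_comparison_test'[OF summable_y_0(1)[of 1]]) auto
  have "(\<lambda>j. if j \<in> {0..k} then u (k - j) * y 1 j else 0) sums (\<Sum>j\<in>{0..k}. u (k - j) * y 1 j)"
    by (rule sums_If_finite_set) simp
  then have "(\<lambda>j. (if j \<in> {0..k} then u (k - j) * y 1 j else 0) - u r * y 1 j)
      sums ((\<Sum>j\<in>{0..k}. u (k - j) * y 1 j) - u r * 0)"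
    by (rule sums_diff[OF _ sums_mult[OF y1_sums]])
  also have "(\<lambda>j. (if j \<in> {0..k} then u (k - j) * y 1 j else 0) - u r * y 1 j) = (\<lambda>j. w j * y 1 j)"
    by (auto simp: w_def algebra_simps)
  also have "(\<Sum>j\<in>{0..k}. u (k - j) * y 1 j) - u r * 0 = fps_nth (Y 1 * U) k"
    unfolding fps_mult_nth[of "Y 1"] by (simp add: Y_def U_def mult.commute)
  also have "Y 1 * U = U * Y 1" by (rule mult.commute)
  finally have s: "(\<lambda>j. w j * y 1 j) sums fps_nth (U * Y 1) k" .
  have sa: "summable (\<lambda>j. \<bar>w j * y 1 j\<bar>)"
    by (rule summable_comparison_test'[OF sm]) (use w in auto)
  have "\<bar>fps_nth (U * Y 1) k\<bar> = \<bar>\<Sum>j. w j * y 1 j\<bar>" using s by (simp add: sums_iff)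
  also have "\<dots> \<le> (\<Sum>j. \<bar>w j * y 1 j\<bar>)" by (rule summable_rabs[OF sa])
  also have "\<dots> \<le> (\<Sum>j. if k < j + r then \<bar>y 1 j\<bar> else 0)" by (intro suminf_le w sa sm)
  finally show ?thesis .
qed

lemma summable_U_Y1: "summable (\<lambda>k. \<bar>fps_nth (U * Y 1) k\<bar>)"
proof (rule summable_comparison_test')
  show "summable (\<lambda>k. \<Sum>j. if k < j + r then \<bar>y 1 j\<bar> else 0)"
    using summable_y_0(1)[of 1] summable_y[of 1 1] by (intro summable_tail_sums) auto
  show "norm \<bar>fps_nth (U * Y 1) k\<bar> \<le> (\<Sum>j. if k < j + r then \<bar>y 1 j\<bar> else 0)" for k
    using abs_U_Y1_le by simp
qed

lemma abs_convolution_U_Y1_le: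
  assumes "\<And>k. \<bar>fps_nth A k\<bar> \<le> B" "B \<ge> 0"
  shows "\<bar>fps_nth (U * Y 1 * A) k\<bar> \<le> B * (\<Sum>k. \<bar>fps_nth (U * Y 1) k\<bar>)"
proof -
  have "\<bar>fps_nth (U * Y 1 * A) k\<bar> \<le> (\<Sum>i=0..k. \<bar>fps_nth (U * Y 1) i * fps_nth A (k - i)\<bar>)"
    unfolding fps_mult_nth[of "U * Y 1"] by (rule sum_abs)
  also have "\<dots> \<le> (\<Sum>i=0..k. B * \<bar>fps_nth (U * Y 1) i\<bar>)"
    by (intro sum_mono) (auto simp: abs_mult mult.commute[of B] intro!: mult_left_mono assms(1))
  also have "\<dots> = B * (\<Sum>i\<in>{0..k}. \<bar>fps_nth (U * Y 1) i\<bar>)" by (simp add: sum_distrib_left)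
  also have "\<dots> \<le> B * (\<Sum>k. \<bar>fps_nth (U * Y 1) k\<bar>)"
    using assms(2) summable_U_Y1 by (intro mult_left_mono sum_le_suminf) auto
  finally show ?thesis .
qed

text \<open>By \<open>first_moment_eq\<close> the moment is the convolution of the absolutely
  summable \<open>U * Y 1\<close> with the bounded \<open>U\<close>.\<close>

lemma first_moment_bounded: "\<exists>B\<ge>0. \<forall>k. \<bar>R (\<lambda>x. x) k\<bar> \<le> B"
proof -
  have "R (\<lambda>x. x) k = fps_nth (U * Y 1 * U) k" for k
    using arg_cong[OF first_moment_eq, of "\<lambda>A. fps_nth A k"] by (simp add: M_def mult.assoc)
  then have "\<bar>R (\<lambda>x. x) k\<bar> \<le> 1 * (\<Sum>k. \<bar>fps_nth (U * Y 1) k\<bar>)" for k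
    using abs_convolution_U_Y1_le[of U 1 k] u_nonneg u_le_1 by (simp add: U_def)
  moreover have "1 * (\<Sum>k. \<bar>fps_nth (U * Y 1) k\<bar>) \<ge> 0" using suminf_nonneg[OF summable_U_Y1] by simp
  ultimately show ?thesis by blast
qed

text \<open>Away from the ends both factors equal \<open>u r\<close>. At most \<open>2 * r\<close>
  indices lie within \<open>r\<close> of an end, each with error at most 1, and the extra 1 is due
  to there being \<open>m + 1\<close> indices.\<close>

lemma U_squared: "\<bar>fps_nth (U * U) m - (u r)\<^sup>2 * real m\<bar> \<le> 2 * real r + 1"
proof -
  define B where "B = {i\<in>{0..m}. i < r \<or> m - i < r}"
  have 1: "fps_nth (U * U) m - (u r)\<^sup>2 * real m = (\<Sum>i=0..m. u i * u (m - i) - (u r)\<^sup>2) + (u r)\<^sup>2"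
    by (simp add: fps_mult_nth U_def sum_subtractf algebra_simps)
  have "\<bar>\<Sum>i=0..m. u i * u (m - i) - (u r)\<^sup>2\<bar> \<le> (\<Sum>i=0..m. if i \<in> B then 1 else 0)"
  proof (rule order_trans[OF sum_abs], rule sum_mono)
    fix i assume i: "i \<in> {0..m}"
    show "\<bar>u i * u (m - i) - (u r)\<^sup>2\<bar> \<le> (if i \<in> B then 1 else 0)"
    proof (cases "i \<in> B")
      case True
      have "0 \<le> u i * u (m - i)" "u i * u (m - i) \<le> 1" "0 \<le> (u r)\<^sup>2" "(u r)\<^sup>2 \<le> 1"
        using mult_le_one[OF u_le_1 u_nonneg u_le_1] power_le_one[OF u_nonneg u_le_1]
        by (simp_all add: u_nonneg)
      then have "\<bar>u i * u (m - i) - (u r)\<^sup>2\<bar> \<le> 1" by linarith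
      then show ?thesis using True by simp
    next
      case False
      then have "u i = u r" "u (m - i) = u r" using i by (auto simp: B_def intro!: u_eq)
      then show ?thesis using False by (simp add: power2_eq_square)
    qed
  qed
  also have "(\<Sum>i=0..m. if i \<in> B then 1 else (0::real)) = real (card B)"
    by (subst sum.If_cases) (auto simp: B_def Int_def intro!: arg_cong[of _ _ card])
  finally have 2: "\<bar>\<Sum>i=0..m. u i * u (m - i) - (u r)\<^sup>2\<bar> \<le> real (card B)" .
  have "card B \<le> card ({..<r} \<union> (\<lambda>j. m - j) ` {..<r})"
  proof (intro card_mono subsetI)
    fix i assume "i \<in> B"
    then have "i < r \<or> i = m - (m - i) \<and> m - i < r" by (auto simp: B_def)
    then show "i \<in> {..<r} \<union> (\<lambda>j. m - j) ` {..<r}" by blast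
  qed auto
  also have "\<dots> \<le> r + r"
    using card_Un_le[of "{..<r}" "(\<lambda>j. m - j) ` {..<r}"] card_image_le[of "{..<r}" "\<lambda>j. m - j"]
    by simp
  finally have "real (card B) \<le> 2 * real r" by simp
  then show ?thesis unfolding 1
    using 2 power_le_one[OF u_nonneg u_le_1, of r 2] zero_le_power2[of "u r"] by linarith
qed

text \<open>Replacing the linear growth of \<open>U * U\<close> at \<open>k - j\<close> by its value
  at \<open>k\<close> costs an error linear in \<open>j\<close>, which the first moment of
  \<open>\<bar>y 2 j\<bar>\<close> absorbs.\<close>

lemma U_squared_convolution:
  "\<exists>B. \<forall>k. \<bar>fps_nth (U * U * Y 2) k - (u r)\<^sup>2 * real k * (var_const q r f * real q ^ r)\<bar> \<le> B"
proof (intro exI allI)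
  fix k
  define c where "c = (u r)\<^sup>2"
  have c: "0 \<le> c" "c \<le> 1" using u_nonneg[of r] u_le_1[of r] by (auto simp: c_def intro: power_le_one)
  define U2 where "U2 = fps_nth (U * U)"
  define w where "w j = (if j \<in> {0..k} then U2 (k - j) else 0) - c * real k" for j
  have w: "\<bar>w j\<bar> \<le> real j + (2 * real r + 1)" for j
  proof (cases "j \<le> k")
    case True
    have "\<bar>U2 (k - j) - c * real (k - j)\<bar> \<le> 2 * real r + 1" using U_squared by (simp add: U2_def c_def)
    moreover have "w j = (U2 (k - j) - c * real (k - j)) - c * real j"
      using True by (simp add: w_def algebra_simps of_nat_diff)
    moreover have "0 \<le> c * real j" "c * real j \<le> real j" using c by (auto simp: mult_left_le_one_le)
    ultimately show ?thesis by linarith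
  next
    case False
    have "0 \<le> c * real k" "c * real k \<le> real k" using c by (auto simp: mult_left_le_one_le)
    then show ?thesis using False by (auto simp: w_def)
  qed
  have sm: "summable (\<lambda>j. real j * \<bar>y 2 j\<bar> + (2 * real r + 1) * \<bar>y 2 j\<bar>)"
    using summable_y[of 1 2] summable_y_0(1)[of 2] by (intro summable_add summable_mult) auto
  have le: "\<bar>w j * y 2 j\<bar> \<le> real j * \<bar>y 2 j\<bar> + (2 * real r + 1) * \<bar>y 2 j\<bar>" for j
    using mult_right_mono[OF w[of j], of "\<bar>y 2 j\<bar>"] by (simp add: abs_mult algebra_simps)
  have "(\<lambda>j. if j \<in> {0..k} then U2 (k - j) * y 2 j else 0) sums (\<Sum>j\<in>{0..k}. U2 (k - j) * y 2 j)"
    by (rule sums_If_finite_set) simp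
  then have "(\<lambda>j. (if j \<in> {0..k} then U2 (k - j) * y 2 j else 0) - c * real k * y 2 j)
      sums ((\<Sum>j\<in>{0..k}. U2 (k - j) * y 2 j) - c * real k * (var_const q r f * real q ^ r))"
    by (rule sums_diff[OF _ sums_mult[OF y2_sums]])
  also have "(\<lambda>j. (if j \<in> {0..k} then U2 (k - j) * y 2 j else 0) - c * real k * y 2 j) = (\<lambda>j. w j * y 2 j)"
    by (auto simp: w_def algebra_simps)
  also have "(\<Sum>j\<in>{0..k}. U2 (k - j) * y 2 j) = fps_nth (Y 2 * (U * U)) k"
    unfolding fps_mult_nth[of "Y 2"] by (simp add: Y_def U2_def mult.commute)
  also have "Y 2 * (U * U) = U * U * Y 2" by (simp add: mult_ac)
  finally have s: "(\<lambda>j. w j * y 2 j) sums (fps_nth (U * U * Y 2) k - c * real k * (var_const q r f * real q ^ r))" .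
  have sa: "summable (\<lambda>j. \<bar>w j * y 2 j\<bar>)"
    by (rule summable_comparison_test'[OF sm]) (use le in auto)
  have "\<bar>\<Sum>j. w j * y 2 j\<bar> \<le> (\<Sum>j. \<bar>w j * y 2 j\<bar>)" by (rule summable_rabs[OF sa])
  also have "\<dots> \<le> (\<Sum>j. real j * \<bar>y 2 j\<bar> + (2 * real r + 1) * \<bar>y 2 j\<bar>)" by (intro suminf_le le sa sm)
  finally show "\<bar>fps_nth (U * U * Y 2) k - (u r)\<^sup>2 * real k * (var_const q r f * real q ^ r)\<bar>
    \<le> (\<Sum>j. real j * \<bar>y 2 j\<bar> + (2 * real r + 1) * \<bar>y 2 j\<bar>)"
    using s by (simp add: sums_iff c_def)
qed

text \<open>The two cross terms \<open>U * Y 1 * M 1\<close> are bounded, so the linear growth comes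
  from \<open>U * U * Y 2\<close> alone, with slope (q^(-r))^2 times the second moment sigma^2 q^r
  of the reward.\<close>

lemma second_moment_asymptotics:
  "\<exists>B. \<forall>k. \<bar>R (\<lambda>x. x\<^sup>2) k - var_const q r f / real q ^ r * real k\<bar> \<le> B"
proof -
  obtain B1 where B1: "B1 \<ge> 0" "\<And>k. \<bar>R (\<lambda>x. x) k\<bar> \<le> B1" using first_moment_bounded by blast
  obtain B2 where B2: "\<And>k. \<bar>fps_nth (U * U * Y 2) k - (u r)\<^sup>2 * real k * (var_const q r f * real q ^ r)\<bar> \<le> B2"
    using U_squared_convolution by blast
  define Q where "Q = B1 * (\<Sum>k. \<bar>fps_nth (U * Y 1) k\<bar>)"
  have Q: "\<bar>fps_nth (U * Y 1 * M 1) k\<bar> \<le> Q" for k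
    unfolding Q_def using B1 by (intro abs_convolution_U_Y1_le) (auto simp: M_def)
  have "\<bar>R (\<lambda>x. x\<^sup>2) k - var_const q r f / real q ^ r * real k\<bar> \<le> 2 * Q + B2" for k
  proof -
    have "M 2 = U * Y 1 * M 1 + U * Y 1 * M 1 + U * U * Y 2"
      unfolding second_moment_eq by (simp only: distrib_left mult_ac)
    then have "fps_nth (M 2) k = fps_nth (U * Y 1 * M 1) k + fps_nth (U * Y 1 * M 1) k + fps_nth (U * U * Y 2) k"
      by (simp only: fps_add_nth)
    moreover have "fps_nth (M 2) k = R (\<lambda>x. x\<^sup>2) k" by (simp add: M_def)
    moreover have "(u r)\<^sup>2 * real k * (var_const q r f * real q ^ r) = var_const q r f / real q ^ r * real k"
      using q by (simp add: u_def power2_eq_square)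
    ultimately show ?thesis using Q[of k] B2[of k] by linarith
  qed
  then show ?thesis by blast
qed

lemma R_expectation:
  fixes G :: "real \<Rightarrow> 'a :: {real_normed_field, banach, second_countable_topology}"
  shows "measure_pmf.expectation (unif_pmf q k) (\<lambda>n. G (h n - \<mu> * real (k + r))) =
    of_nat q ^ r * R G (k + r)"
  using q by (simp add: expectation_unif_pmf R_def power_add scaleR_conv_of_real field_simps)

lemma mean_asymptotics:
  "(\<lambda>k. measure_pmf.expectation (unif_pmf q k) h - \<mu> * real k) \<in> O(\<lambda>_. 1)"
proof -
  obtain B where B: "\<And>k. \<bar>R (\<lambda>x. x) k\<bar> \<le> B" using first_moment_bounded by blast
  have "\<bar>measure_pmf.expectation (unif_pmf q k) h - \<mu> * real k\<bar> \<le> real q ^ r * B + \<bar>\<mu> * real r\<bar>" for k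
  proof -
    have "real q ^ r * R (\<lambda>x. x) (k + r) = measure_pmf.expectation (unif_pmf q k) h - \<mu> * real (k + r)"
      using q unfolding R_expectation[symmetric]
      by (simp add: expectation_unif_pmf sum_subtractf divide_inverse[symmetric] field_simps)
    moreover have "\<bar>real q ^ r * R (\<lambda>x. x) (k + r)\<bar> \<le> real q ^ r * B"
      using B[of "k + r"] by (simp add: abs_mult mult_left_mono)
    ultimately show ?thesis by (simp add: algebra_simps)
  qed
  then show ?thesis by (intro bigoI always_eventually) auto
qed

lemma variance_asymptotics:
  "(\<lambda>k. measure_pmf.variance (unif_pmf q k) h - var_const q r f * real k) \<in> O(\<lambda>_. 1)"
proof -
  obtain B where B: "B \<ge> 0" "\<And>k. \<bar>R (\<lambda>x. x) k\<bar> \<le> B" using first_moment_bounded by blast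
  obtain B2 where B2: "\<And>k. \<bar>R (\<lambda>x. x\<^sup>2) k - var_const q r f / real q ^ r * real k\<bar> \<le> B2"
    using second_moment_asymptotics by blast
  define X where "X = real q ^ r"
  have X: "X > 0" using q by (simp add: X_def)
  have "\<bar>measure_pmf.variance (unif_pmf q k) h - var_const q r f * real k\<bar>
    \<le> X * B2 + \<bar>var_const q r f * real r\<bar> + (X * B)\<^sup>2" for k
  proof -
    define c where "c = \<mu> * real (k + r)"
    have ex: "measure_pmf.expectation (unif_pmf q k) g = (\<Sum>n<q ^ k. g n) / real (card {..<q ^ k})" for g :: "nat \<Rightarrow> real"
      using q by (simp add: expectation_unif_pmf divide_inverse_commute)
    have "measure_pmf.variance (unif_pmf q k) h =
      measure_pmf.expectation (unif_pmf q k) (\<lambda>n. (h n - c)\<^sup>2) - (measure_pmf.expectation (unif_pmf q k) (\<lambda>n. h n - c))\<^sup>2"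
      unfolding ex using q by (intro mean_square_deviation) (auto simp: lessThan_empty_iff)
    also have "\<dots> = X * R (\<lambda>x. x\<^sup>2) (k + r) - (X * R (\<lambda>x. x) (k + r))\<^sup>2"
      unfolding c_def using R_expectation[of k "\<lambda>x. x\<^sup>2 :: real"] R_expectation[of k "\<lambda>x. x :: real"]
      by (simp add: X_def)
    finally have v: "measure_pmf.variance (unif_pmf q k) h = \<dots>" .
    have "\<bar>X * R (\<lambda>x. x\<^sup>2) (k + r) - var_const q r f * real (k + r)\<bar> \<le> X * B2"
    proof -
      have "X * R (\<lambda>x. x\<^sup>2) (k + r) - var_const q r f * real (k + r) =
        X * (R (\<lambda>x. x\<^sup>2) (k + r) - var_const q r f / X * real (k + r))"
        using X by (simp add: right_diff_distrib)
      then show ?thesis using B2[of "k + r"] X by (simp add: abs_mult X_def[symmetric])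
    qed
    moreover have "(X * R (\<lambda>x. x) (k + r))\<^sup>2 \<le> (X * B)\<^sup>2"
      using B X by (intro power2_le_iff_abs_le[THEN iffD2]) (auto simp: abs_mult mult_left_mono)
    moreover have "(X * R (\<lambda>x. x) (k + r))\<^sup>2 \<ge> 0" by simp
    moreover have "var_const q r f * real (k + r) = var_const q r f * real k + var_const q r f * real r"
      by (simp add: algebra_simps)
    ultimately show ?thesis unfolding v by linarith
  qed
  then show ?thesis by (intro bigoI always_eventually) auto
qed

text \<open>A vanishing second moment makes every centred reward zero. The zero cycle, of length 1
  and reward 0, then forces mu = 0, so \<open>h\<close> vanishes on all cycles, and peeling off
  lowest cycles carries this to every number.\<close>

lemma var_const_nonneg: "var_const q r f \<ge> 0"
  and var_const_eq_0D: "var_const q r f = 0 \<Longrightarrow> f = (\<lambda>_. 1)"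
proof -
  have y0: "y 2 j \<ge> 0" for j using q by (auto simp: y_def intro!: divide_nonneg_nonneg sum_nonneg)
  have X: "real q ^ r > 0" using q by simp
  have "var_const q r f * real q ^ r \<ge> 0"
    using y0 y2_sums sums_le[OF _ sums_zero y2_sums] by auto
  then show "var_const q r f \<ge> 0" using X by (simp add: zero_le_mult_iff)
  assume "var_const q r f = 0"
  then have "(\<Sum>j. y 2 j) = 0" using y2_sums by (simp add: sums_iff)
  then have "y 2 j = 0" for j
    using suminf_eq_zero_iff[OF summable_y_0(2)[of 2] y0] by auto
  then have z: "h b = \<mu> * real j" if "b \<in> cycles q r j" for b j
  proof -
    have "(\<Sum>b\<in>cycles q r j. (h b - \<mu> * real j)\<^sup>2) = 0"
      using \<open>\<And>j. y 2 j = 0\<close>[of j] q by (auto simp: y_def)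
    then show ?thesis using that finite_cycles[OF q, of r j] by (simp add: sum_nonneg_eq_0_iff)
  qed
  have "0 \<in> cycles q r 1" by (simp add: cycles_def)
  then have "\<mu> = 0" using z[of 0 1] by simp
  have h0: "h n = 0" for n
  proof (induction n rule: less_induct)
    case (less n)
    obtain j where j: "n mod q ^ j \<in> cycles q r j" using cycle_exists[OF q] by blast
    define a where "a = n div q ^ j"
    have hb: "h (n mod q ^ j) = 0" using z[OF j] \<open>\<mu> = 0\<close> by simp
    have hn: "h n = h a + h (n mod q ^ j)" using h_cycle[OF j, of a] by (simp add: a_def)
    show ?case
    proof (cases "n = 0")
      case False
      have "q ^ j > 1" using cycles_pos[OF q j] q by (intro one_less_power) auto
      then have "a < n" using False by (simp add: a_def)
      then show ?thesis using less hn hb by simp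
    qed simp
  qed
  show "f = (\<lambda>_. 1)"
  proof
    show "f n = 1" for n using h0[of n] pos[of n] by (simp add: h_def)
  qed
qed

end

section \<open>The central limit theorem\<close>

lemma sum_increments:
  fixes x :: "nat \<Rightarrow> 'a :: ab_group_add"
  assumes "m \<le> n"
  shows "x n - x m = (\<Sum>i\<in>{m<..n}. x i - x (i - 1))"
  using assms
proof (induction n rule: dec_induct)
  case (step n)
  then have "{m<..Suc n} = insert (Suc n) {m<..n}" by auto
  then have "(\<Sum>i\<in>{m<..Suc n}. x i - x (i - 1)) = (x (Suc n) - x n) + (x n - x m)"
    using step.IH by simp
  then show ?case by simp
qed simp

text \<open>Each \<open>D i\<close> lies in the windows of at most \<open>j\<close> values of
  \<open>k\<close>, and at most \<open>j\<close> values of \<open>k\<close> above \<open>r\<close>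
  fall into the second case. The constant 2 bounds the distance of two points of the unit
  disc.\<close>

lemma sum_window_le:
  fixes D :: "nat \<Rightarrow> real"
  assumes "\<And>i. D i \<ge> 0"
  shows "(\<Sum>k\<in>{r<..K}. if j + r \<le> k then (\<Sum>i\<in>{k - j<..k - 1}. D i) else 2)
    \<le> real j * ((\<Sum>k\<in>{r<..K}. D k) + 2)"
proof -
  have "(\<Sum>k\<in>{r<..K}. if j + r \<le> k then (\<Sum>i\<in>{k - j<..k - 1}. D i) else 2)
    \<le> (\<Sum>k\<in>{r<..K}. (\<Sum>i\<in>{r<..K}. if i < k \<and> k < i + j then D i else 0) + (if k < j + r then 2 else 0))"
  proof (rule sum_mono)
    fix k assume k: "k \<in> {r<..K}"
    show "(if j + r \<le> k then (\<Sum>i\<in>{k - j<..k - 1}. D i) else 2)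
      \<le> (\<Sum>i\<in>{r<..K}. if i < k \<and> k < i + j then D i else 0) + (if k < j + r then 2 else 0)"
    proof (cases "j + r \<le> k")
      case True
      have "(\<Sum>i\<in>{k - j<..k - 1}. D i) = (\<Sum>i\<in>{k - j<..k - 1}. if i < k \<and> k < i + j then D i else 0)"
        using True k by (intro sum.cong) auto
      also have "\<dots> \<le> (\<Sum>i\<in>{r<..K}. if i < k \<and> k < i + j then D i else 0)"
        using True k assms by (intro sum_mono2) auto
      finally show ?thesis using True by simp
    next
      case False
      have "(\<Sum>i\<in>{r<..K}. if i < k \<and> k < i + j then D i else 0) \<ge> 0"
        using assms by (intro sum_nonneg) auto
      then show ?thesis using False by simp
    qed
  qed
  also have "\<dots> = (\<Sum>k\<in>{r<..K}. \<Sum>i\<in>{r<..K}. if i < k \<and> k < i + j then D i else 0)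
      + (\<Sum>k\<in>{r<..K}. if k < j + r then 2 else 0)"
    by (rule sum.distrib)
  also have "\<dots> = (\<Sum>i\<in>{r<..K}. \<Sum>k\<in>{r<..K}. if i < k \<and> k < i + j then D i else 0)
      + (\<Sum>k\<in>{r<..K}. if k < j + r then 2 else 0)"
    by (subst sum.swap) simp
  also have "\<dots> \<le> (\<Sum>i\<in>{r<..K}. real j * D i) + real j * 2"
  proof (rule add_mono[OF sum_mono])
    fix i
    have "(\<Sum>k\<in>{r<..K}. if i < k \<and> k < i + j then D i else 0) = real (card {k\<in>{r<..K}. i < k \<and> k < i + j}) * D i"
      by (simp add: sum.If_cases Int_def)
    also have "card {k\<in>{r<..K}. i < k \<and> k < i + j} \<le> card {i<..<i + j}" by (intro card_mono) auto
    then have "real (card {k\<in>{r<..K}. i < k \<and> k < i + j}) * D i \<le> real j * D i"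
      using assms by (intro mult_right_mono) auto
    finally show "(\<Sum>k\<in>{r<..K}. if i < k \<and> k < i + j then D i else 0) \<le> real j * D i" .
  next
    have "(\<Sum>k\<in>{r<..K}. if k < j + r then 2 else (0::real)) = real (card {k\<in>{r<..K}. k < j + r}) * 2"
      by (simp add: sum.If_cases Int_def)
    moreover have "card {k\<in>{r<..K}. k < j + r} \<le> card {r<..<j + r}" by (intro card_mono) auto
    ultimately show "(\<Sum>k\<in>{r<..K}. if k < j + r then 2 else (0::real)) \<le> real j * 2" by simp
  qed
  finally show ?thesis by (simp add: sum_distrib_left algebra_simps)
qed

text \<open>A sequence with small increments \<open>\<Sum>j\<le>k. e j * x (k - j)\<close> behaves like a solution of the
  first-order recursion \<open>x k = \<rho> * x (k - 1)\<close> with \<open>\<rho> \<approx> 1 + \<epsilon>\<close>, where \<open>\<epsilon>\<close> is the sum of \<open>e\<close>: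
  replacing \<open>x (k - j)\<close> by \<open>x (k - 1)\<close> costs a further increment.\<close>

lemma delay_recursion_estimate:
  fixes x e :: "nat \<Rightarrow> complex" and \<eta> :: "nat \<Rightarrow> real"
  assumes rec: "\<And>k. k > r \<Longrightarrow> x k - x (k - 1) = (\<Sum>j=0..k. e j * x (k - j))"
    and e0: "e 0 = 0" and x1: "\<And>k. norm (x k) \<le> 1"
    and S: "S \<ge> 0" and e_le: "\<And>j. norm (e j) \<le> S * \<eta> j"
    and \<eta>: "\<And>j. \<eta> j \<ge> 0" "summable \<eta>" "summable (\<lambda>j. real j * \<eta> j)"
    and \<epsilon>: "e sums \<epsilon>"
    and small: "S * (\<Sum>j. real j * \<eta> j) \<le> 1 / 2"
    and lam: "norm \<rho> \<le> 1" and K: "K \<ge> r"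
  shows "norm (x K - \<rho> ^ (K - r) * x r) \<le>
    S * (\<Sum>j. real j * \<eta> j) * (2 * norm \<epsilon> * real K + 4) + real K * norm (1 + \<epsilon> - \<rho>)"
proof -
  define A where "A = (\<Sum>j. real j * \<eta> j)"
  define d where "d k = x k - x (k - 1)" for k
  define D where "D k = norm (d k)" for k
  define \<Delta> where "\<Delta> = (\<Sum>k\<in>{r<..K}. D k)"
  \<comment> \<open>A bound for the error of replacing \<open>x (k - j)\<close>, read as 0 for
    \<open>j > k\<close>, by \<open>x (k - 1)\<close>: the increments in between if all their
    indices exceed \<open>r\<close>, and the trivial bound 2 otherwise.\<close>
  define w where "w k j = (if j + r \<le> k then (\<Sum>i\<in>{k - j<..k - 1}. D i) else 2)" for k j
  have D0: "D i \<ge> 0" for i by (simp add: D_def)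
  have w0: "w k j \<ge> 0" for k j using D0 by (auto simp: w_def intro!: sum_nonneg)
  have se: "summable (\<lambda>j. norm (e j))"
    by (rule summable_comparison_test'[OF summable_mult[OF \<eta>(2), of S]]) (use e_le in simp)
  have w_sum: "summable (\<lambda>j. S * (\<eta> j * w k j))" for k
  proof (rule summable_comparison_test')
    define C where "C = (\<Sum>i\<in>{..k}. D i) + 2"
    show "summable (\<lambda>j. S * C * \<eta> j)" using \<eta>(2) by (rule summable_mult)
    have "w k j \<le> C" for j
    proof (cases "j + r \<le> k")
      case True
      have "(\<Sum>i\<in>{k - j<..k - 1}. D i) \<le> (\<Sum>i\<in>{..k}. D i)" using D0 by (intro sum_mono2) auto
      then show ?thesis using True by (simp add: w_def C_def)
    next
      case False
      then show ?thesis using sum_nonneg[of "{..k}" D] D0 by (simp add: w_def C_def)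
    qed
    then have "\<eta> j * w k j \<le> \<eta> j * C" for j using \<eta>(1) by (intro mult_left_mono) auto
    then have "S * (\<eta> j * w k j) \<le> S * (\<eta> j * C)" for j using S by (rule mult_left_mono)
    then show "norm (S * (\<eta> j * w k j)) \<le> S * C * \<eta> j" for j
      using S w0[of k j] \<eta>(1)[of j] by (simp add: mult_ac)
  qed
  have step: "norm (d k - \<epsilon> * x (k - 1)) \<le> (\<Sum>j. S * (\<eta> j * w k j))" if k: "k > r" for k
  proof -
    define z where "z j = (if j \<in> {0..k} then x (k - j) else 0) - x (k - 1)" for j
    have "(\<lambda>j. if j \<in> {0..k} then e j * x (k - j) else 0) sums (\<Sum>j\<in>{0..k}. e j * x (k - j))"
      by (rule sums_If_finite_set) simp
    then have "(\<lambda>j. (if j \<in> {0..k} then e j * x (k - j) else 0) - e j * x (k - 1))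
        sums ((\<Sum>j\<in>{0..k}. e j * x (k - j)) - \<epsilon> * x (k - 1))"
      by (rule sums_diff[OF _ sums_mult2[OF \<epsilon>]])
    also have "(\<lambda>j. (if j \<in> {0..k} then e j * x (k - j) else 0) - e j * x (k - 1)) = (\<lambda>j. e j * z j)"
      by (auto simp: z_def algebra_simps)
    finally have s: "(\<lambda>j. e j * z j) sums (d k - \<epsilon> * x (k - 1))" using rec[OF k] by (simp add: d_def)
    have zle: "norm (e j * z j) \<le> S * (\<eta> j * w k j)" for j
    proof (cases "j = 0")
      case True
      then show ?thesis using e0 S w0[of k 0] \<eta>(1)[of 0] by simp
    next
      case j: False
      have "norm (z j) \<le> w k j"
      proof (cases "j + r \<le> k")
        case True
        have "x (k - 1) - x (k - j) = (\<Sum>i\<in>{k - j<..k - 1}. d i)"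
          unfolding d_def using j by (intro sum_increments) auto
        moreover have "norm (z j) = norm (x (k - 1) - x (k - j))"
          using True by (simp add: z_def norm_minus_commute)
        ultimately have "norm (z j) \<le> (\<Sum>i\<in>{k - j<..k - 1}. D i)"
          unfolding D_def by (simp add: norm_sum)
        then show ?thesis using True by (simp add: w_def)
      next
        case False
        have "norm (if j \<in> {0..k} then x (k - j) else 0) \<le> 1" using x1 by simp
        then have "norm (z j) \<le> 1 + 1" unfolding z_def using x1[of "k - 1"]
          by (intro norm_triangle_le_diff) linarith
        then show ?thesis using False by (simp add: w_def)
      qed
      then have "norm (e j) * norm (z j) \<le> (S * \<eta> j) * w k j"
        using e_le S \<eta>(1) by (intro mult_mono) auto
      then show ?thesis by (simp add: norm_mult mult.assoc)
    qed
    have sn: "summable (\<lambda>j. norm (e j * z j))"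
      by (rule summable_comparison_test'[OF w_sum[of k]]) (use zle in simp)
    have "norm (d k - \<epsilon> * x (k - 1)) = norm (\<Sum>j. e j * z j)" using s by (simp add: sums_iff)
    also have "\<dots> \<le> (\<Sum>j. norm (e j * z j))" by (rule summable_norm[OF sn])
    also have "\<dots> \<le> (\<Sum>j. S * (\<eta> j * w k j))" by (intro suminf_le zle sn w_sum)
    finally show ?thesis .
  qed
  have "(\<Sum>k\<in>{r<..K}. norm (d k - \<epsilon> * x (k - 1))) \<le> (\<Sum>k\<in>{r<..K}. \<Sum>j. S * (\<eta> j * w k j))"
    by (intro sum_mono step) auto
  also have "\<dots> = (\<Sum>j. \<Sum>k\<in>{r<..K}. S * (\<eta> j * w k j))"
    by (intro suminf_sum[symmetric] w_sum)
  also have "\<dots> \<le> (\<Sum>j. S * (\<Delta> + 2) * (real j * \<eta> j))"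
  proof (rule suminf_le)
    fix j
    have "(\<Sum>k\<in>{r<..K}. S * (\<eta> j * w k j)) = S * \<eta> j * (\<Sum>k\<in>{r<..K}. w k j)"
      by (simp add: sum_distrib_left mult.assoc)
    also have "\<dots> \<le> S * \<eta> j * (real j * (\<Delta> + 2))"
      unfolding w_def \<Delta>_def using S \<eta>(1) D0 by (intro mult_left_mono sum_window_le) auto
    finally show "(\<Sum>k\<in>{r<..K}. S * (\<eta> j * w k j)) \<le> S * (\<Delta> + 2) * (real j * \<eta> j)"
      by (simp only: mult_ac)
  qed (use \<eta>(3) in \<open>auto intro!: summable_sum w_sum summable_mult\<close>)
  also have "\<dots> = S * A * (\<Delta> + 2)" using \<eta>(3) by (simp add: suminf_mult A_def)
  finally have est: "(\<Sum>k\<in>{r<..K}. norm (d k - \<epsilon> * x (k - 1))) \<le> S * A * (\<Delta> + 2)" .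
  have A0: "A \<ge> 0" unfolding A_def using \<eta> by (intro suminf_nonneg) auto
  have \<Delta>0: "\<Delta> \<ge> 0" unfolding \<Delta>_def using D0 by (intro sum_nonneg)
  have "\<Delta> \<le> (\<Sum>k\<in>{r<..K}. norm (d k - \<epsilon> * x (k - 1)) + norm \<epsilon>)"
    unfolding \<Delta>_def D_def
  proof (rule sum_mono)
    fix k
    have "norm (d k) \<le> norm (d k - \<epsilon> * x (k - 1)) + norm (\<epsilon> * x (k - 1))"
      using norm_triangle_ineq[of "d k - \<epsilon> * x (k - 1)" "\<epsilon> * x (k - 1)"] by simp
    moreover have "norm (\<epsilon> * x (k - 1)) \<le> norm \<epsilon>"
      using x1[of "k - 1"] by (simp add: norm_mult mult_left_le)
    ultimately show "norm (d k) \<le> norm (d k - \<epsilon> * x (k - 1)) + norm \<epsilon>" by linarith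
  qed
  also have "\<dots> = (\<Sum>k\<in>{r<..K}. norm (d k - \<epsilon> * x (k - 1))) + real (K - r) * norm \<epsilon>"
    by (simp add: sum.distrib)
  also have "\<dots> \<le> S * A * (\<Delta> + 2) + real K * norm \<epsilon>"
    using est by (intro add_mono mult_right_mono) auto
  \<comment> \<open>The total variation \<open>\<Delta>\<close> is bounded by half of itself plus
    known terms, so it can be solved for. This is the purpose of the hypothesis
    \<open>small\<close>.\<close>
  also have "S * A * (\<Delta> + 2) \<le> 1 / 2 * (\<Delta> + 2)"
    using small \<Delta>0 unfolding A_def[symmetric] by (intro mult_right_mono) auto
  finally have "\<Delta> \<le> 1 / 2 * (\<Delta> + 2) + real K * norm \<epsilon>" by simp
  then have "\<Delta> + 2 \<le> 2 * (real K * norm \<epsilon>) + 4" by (simp add: field_simps)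
  then have "\<Delta> + 2 \<le> 2 * norm \<epsilon> * real K + 4" by (simp only: mult_ac)
  then have "S * A * (\<Delta> + 2) \<le> S * A * (2 * norm \<epsilon> * real K + 4)"
    using S A0 by (intro mult_left_mono) auto
  then have est2: "(\<Sum>k\<in>{r<..K}. norm (d k - \<epsilon> * x (k - 1))) \<le> S * A * (2 * norm \<epsilon> * real K + 4)"
    using est by linarith
  \<comment> \<open>Because \<open>norm \<rho> \<le> 1\<close>, the errors of the single steps add
    up without being amplified.\<close>
  have "norm (x K - \<rho> ^ (K - r) * x r) \<le> (\<Sum>k\<in>{r<..K}. norm (x k - \<rho> * x (k - 1)))"
    using K
  proof (induction K rule: dec_induct)
    case (step n)
    have "x (Suc n) - \<rho> ^ (Suc n - r) * x r = (x (Suc n) - \<rho> * x n) + \<rho> * (x n - \<rho> ^ (n - r) * x r)"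
      using step(1) by (simp add: Suc_diff_le algebra_simps)
    then have "norm (x (Suc n) - \<rho> ^ (Suc n - r) * x r) \<le>
        norm (x (Suc n) - \<rho> * x n) + norm \<rho> * norm (x n - \<rho> ^ (n - r) * x r)"
      by (metis norm_mult norm_triangle_ineq)
    also have "norm \<rho> * norm (x n - \<rho> ^ (n - r) * x r) \<le> norm (x n - \<rho> ^ (n - r) * x r)"
      using lam by (simp add: mult_left_le_one_le)
    also have "\<dots> \<le> (\<Sum>k\<in>{r<..n}. norm (x k - \<rho> * x (k - 1)))" by (rule step.IH)
    also have "norm (x (Suc n) - \<rho> * x n) + (\<Sum>k\<in>{r<..n}. norm (x k - \<rho> * x (k - 1)))
        = (\<Sum>k\<in>{r<..Suc n}. norm (x k - \<rho> * x (k - 1)))"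
    proof -
      have "{r<..Suc n} = insert (Suc n) {r<..n}" using step(1) by auto
      then show ?thesis by simp
    qed
    finally show ?case by simp
  qed simp
  also have "\<dots> \<le> (\<Sum>k\<in>{r<..K}. norm (d k - \<epsilon> * x (k - 1)) + norm (1 + \<epsilon> - \<rho>))"
  proof (rule sum_mono)
    fix k
    have "x k - \<rho> * x (k - 1) = (d k - \<epsilon> * x (k - 1)) + (1 + \<epsilon> - \<rho>) * x (k - 1)"
      by (simp add: d_def algebra_simps)
    then have "norm (x k - \<rho> * x (k - 1)) \<le> norm (d k - \<epsilon> * x (k - 1)) + norm ((1 + \<epsilon> - \<rho>) * x (k - 1))"
      by (metis norm_triangle_ineq)
    moreover have "norm ((1 + \<epsilon> - \<rho>) * x (k - 1)) \<le> norm (1 + \<epsilon> - \<rho>)"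
      using x1[of "k - 1"] by (simp add: norm_mult mult_left_le)
    ultimately show "norm (x k - \<rho> * x (k - 1)) \<le> norm (d k - \<epsilon> * x (k - 1)) + norm (1 + \<epsilon> - \<rho>)"
      by linarith
  qed
  also have "\<dots> = (\<Sum>k\<in>{r<..K}. norm (d k - \<epsilon> * x (k - 1))) + real (K - r) * norm (1 + \<epsilon> - \<rho>)"
    by (simp add: sum.distrib)
  also have "\<dots> \<le> S * A * (2 * norm \<epsilon> * real K + 4) + real K * norm (1 + \<epsilon> - \<rho>)"
    using est2 by (intro add_mono mult_right_mono) auto
  finally show ?thesis unfolding A_def .
qed

lemma exp_minus_second_order:
  fixes v :: real
  assumes "v \<ge> 0"
  shows "\<bar>1 - v - exp (- v)\<bar> \<le> v\<^sup>2"
proof -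
  have "1 - v \<le> exp (- v)" using exp_ge_add_one_self[of "- v"] by simp
  moreover have "exp (- v) \<le> 1 - v + v\<^sup>2"
  proof -
    have "exp (- v) \<le> 1 / (1 + v)"
      using exp_ge_add_one_self[of v] assms by (simp add: exp_minus inverse_eq_divide frac_le)
    also have "\<dots> \<le> 1 - v + v\<^sup>2"
    proof -
      have "(1 - v + v\<^sup>2) * (1 + v) = 1 + v ^ 3"
        by (simp add: algebra_simps power2_eq_square power3_eq_cube)
      then have "1 \<le> (1 - v + v\<^sup>2) * (1 + v)" using assms by simp
      then show ?thesis using assms by (simp add: divide_le_eq)
    qed
    finally show ?thesis .
  qed
  ultimately show ?thesis by linarith
qed

section \<open>Characteristic functions of renewal words\<close>

context positive_quasimultiplicative
begin

text \<open>The characteristic function of the centred sum restricted to the renewal event, so its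
  value at \<open>s = 0\<close> is \<open>u k\<close> and not 1. Likewise \<open>pc s j\<close>
  belongs to cycles of length \<open>j\<close> and has mass \<open>p j\<close>.\<close>

definition cf :: "real \<Rightarrow> nat \<Rightarrow> complex" where "cf s = R (\<lambda>x. iexp (s * x))"

definition pc :: "real \<Rightarrow> nat \<Rightarrow> complex" where
  "pc s j = (\<Sum>b\<in>cycles q r j. iexp (s * (h b - \<mu> * real j))) / of_nat q ^ j"

lemma norm_iexp: "norm (iexp x) = 1"
  by (simp add: norm_exp_i_times)

lemma cf_rec:
  assumes "k \<ge> 1"
  shows "cf s k = (\<Sum>j=0..k. pc s j * cf s (k - j))"
proof -
  have "R (\<lambda>x. iexp (s * (x + c))) m = iexp (s * c) * cf s m" for c m
    by (simp add: cf_def R_def distrib_left exp_add sum_distrib_left mult_ac)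
  note shift = this
  have "cf s k = (\<Sum>j=0..k. (\<Sum>b\<in>cycles q r j. R (\<lambda>x. iexp (s * (x + (h b - \<mu> * real j)))) (k - j)) / of_nat q ^ j)"
    unfolding cf_def by (rule R_rec_0[OF assms])
  also have "\<dots> = (\<Sum>j=0..k. pc s j * cf s (k - j))"
    by (simp only: shift sum_distrib_right[symmetric] pc_def times_divide_eq_left)
  finally show ?thesis .
qed

lemma cf_0: "cf s 0 = 1"
  by (simp add: cf_def R_0)

lemma norm_cf_le: "norm (cf s k) \<le> 1"
proof -
  have "norm (\<Sum>n<q ^ (k - r). iexp (s * (h n - \<mu> * real k)))
      \<le> (\<Sum>n<q ^ (k - r). norm (iexp (s * (h n - \<mu> * real k))))" by (rule norm_sum)
  also have "\<dots> = real q ^ (k - r)" by (simp only: norm_iexp sum_constant) simp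
  also have "\<dots> \<le> real q ^ k" using q by (simp add: power_increasing)
  finally show ?thesis using q by (simp add: cf_def R_def norm_divide norm_power divide_le_eq)
qed

definition e :: "real \<Rightarrow> nat \<Rightarrow> complex" where
  "e s j = (\<Sum>i=0..j. of_real (fps_nth V i) * (pc s (j - i) - of_real (p (j - i))))"

text \<open>For the generating functions \<open>X\<close> of \<open>cf s\<close> and
  \<open>F\<close> of \<open>pc s\<close>, one has
  \<open>(1 - fps_X) * X = V * (1 - P) * X = V + V * (F - P) * X\<close>. The polynomial
  \<open>V\<close> is invisible beyond index \<open>r\<close>, and \<open>e s\<close> is the
  coefficient sequence of \<open>V * (F - P)\<close>.\<close>

lemma cf_increment:
  assumes "k > r"
  shows "cf s k - cf s (k - 1) = (\<Sum>j=0..k. e s j * cf s (k - j))"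
proof -
  define X where "X = Abs_fps (cf s)"
  define F where "F = Abs_fps (pc s)"
  define PC :: "complex fps" where "PC = Abs_fps (\<lambda>j. of_real (p j))"
  define VC :: "complex fps" where "VC = Abs_fps (\<lambda>j. of_real (fps_nth V j))"
  have X: "X = 1 + F * X"
  proof (rule fps_ext)
    show "fps_nth X k = fps_nth (1 + F * X) k" for k
      using cf_rec[of k s] by (cases "k = 0") (simp_all add: X_def F_def fps_mult_nth cf_0 pc_def cycles_0)
  qed
  have "VC * (1 - PC) = 1 - fps_X"
  proof (rule fps_ext)
    fix n
    have "fps_nth (V * (1 - P)) n = fps_nth (1 - fps_X :: real fps) n" by (simp add: V_renewal)
    then have "complex_of_real (fps_nth (V * (1 - P)) n) = of_real (fps_nth (1 - fps_X :: real fps) n)"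
      by simp
    also have "complex_of_real (fps_nth (V * (1 - P)) n) = fps_nth (VC * (1 - PC)) n"
    proof -
      have "complex_of_real (fps_nth (1 - P) m) = fps_nth (1 - PC) m" for m
        by (cases "m = 0") (simp_all add: P_def PC_def)
      then show ?thesis by (simp only: fps_mult_nth of_real_sum of_real_mult VC_def fps_nth_Abs_fps)
    qed
    also have "complex_of_real (fps_nth (1 - fps_X :: real fps) n) = fps_nth (1 - fps_X) n"
      by (simp add: fps_X_def)
    finally show "fps_nth (VC * (1 - PC)) n = fps_nth (1 - fps_X) n" .
  qed
  then have "X - fps_X * X = VC * (1 - PC) * X" by (simp add: left_diff_distrib)
  also have "\<dots> = VC * (X - F * X) + VC * (F - PC) * X" by (simp add: algebra_simps)
  also have "X - F * X = 1" using X by (metis add_diff_cancel_right')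
  finally have "fps_nth (X - fps_X * X) k = fps_nth (VC + VC * (F - PC) * X) k" by simp
  moreover have "fps_nth (VC * (F - PC) * X) k = (\<Sum>j=0..k. e s j * cf s (k - j))"
  proof -
    have "fps_nth (VC * (F - PC)) j = e s j" for j
      by (simp add: fps_mult_nth VC_def F_def PC_def e_def)
    then show ?thesis by (simp only: fps_mult_nth[of _ X]) (simp add: X_def)
  qed
  moreover have "fps_nth VC k = 0" using V_nth_0[OF assms] by (simp add: VC_def)
  moreover have "fps_nth (X - fps_X * X) k = cf s k - cf s (k - 1)" using assms by (simp add: X_def)
  ultimately show ?thesis by simp
qed

lemma e_0: "e s 0 = 0"
  by (simp add: e_def pc_def cycles_0)

lemma norm_cycle_average_le:
  fixes g :: "nat \<Rightarrow> complex"
  assumes "\<And>b. b \<in> cycles q r j \<Longrightarrow> norm (g b) \<le> C"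
  shows "norm ((\<Sum>b\<in>cycles q r j. g b) / of_nat q ^ j) \<le> C * p j"
proof -
  have "norm (\<Sum>b\<in>cycles q r j. g b) \<le> real (card (cycles q r j)) * C"
    using assms by (rule sum_norm_bound)
  then show ?thesis using q by (simp add: norm_divide norm_power p_def divide_right_mono mult.commute)
qed

lemma pc_diff_le: "norm (pc s j - of_real (p j)) \<le> \<bar>s\<bar> * (L * (real j * p j))"
proof -
  have "pc s j - of_real (p j) = (\<Sum>b\<in>cycles q r j. iexp (s * (h b - \<mu> * real j)) - 1) / of_nat q ^ j"
    by (simp add: pc_def p_def sum_subtractf diff_divide_distrib)
  moreover have "norm \<dots> \<le> \<bar>s\<bar> * (L * real j) * p j"
  proof (rule norm_cycle_average_le)
    fix b assume b: "b \<in> cycles q r j"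
    have "norm (iexp (s * (h b - \<mu> * real j)) - 1) \<le> \<bar>s * (h b - \<mu> * real j)\<bar>"
      using iexp_approx1[of "s * (h b - \<mu> * real j)" 0] by simp
    also have "\<dots> \<le> \<bar>s\<bar> * (L * real j)"
      unfolding abs_mult using cycle_reward_le[OF b] by (intro mult_left_mono) auto
    finally show "norm (iexp (s * (h b - \<mu> * real j)) - 1) \<le> \<bar>s\<bar> * (L * real j)" .
  qed
  ultimately show ?thesis by (simp only: mult.assoc)
qed

lemma pc_expansion:
  "norm (pc s j - of_real (p j) - (\<i> * of_real (s * y 1 j) - of_real (s\<^sup>2 / 2 * y 2 j)))
    \<le> \<bar>s\<bar> ^ 3 * (L ^ 3 / 6 * (real j ^ 3 * p j))"
proof -
  define Y where "Y b = h b - \<mu> * real j" for b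
  have "pc s j - of_real (p j) - (\<i> * of_real (s * y 1 j) - of_real (s\<^sup>2 / 2 * y 2 j)) =
    (\<Sum>b\<in>cycles q r j. iexp (s * Y b) - (1 + \<i> * of_real (s * Y b) - of_real ((s * Y b)\<^sup>2 / 2))) / of_nat q ^ j"
  proof -
    have "(\<Sum>b\<in>cycles q r j. iexp (s * Y b) - (1 + \<i> * of_real (s * Y b) - of_real ((s * Y b)\<^sup>2 / 2))) =
      (\<Sum>b\<in>cycles q r j. iexp (s * Y b)) - of_nat (card (cycles q r j)) -
      (\<i> * of_real (s * (\<Sum>b\<in>cycles q r j. Y b ^ 1)) - of_real (s\<^sup>2 / 2 * (\<Sum>b\<in>cycles q r j. Y b ^ 2)))"
      by (simp add: sum_subtractf sum.distrib sum_distrib_left power_mult_distrib)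
    then show ?thesis
      by (simp only: pc_def p_def y_def Y_def[symmetric]) (simp add: diff_divide_distrib)
  qed
  moreover have "norm \<dots> \<le> \<bar>s\<bar> ^ 3 * (L ^ 3 / 6 * real j ^ 3) * p j"
  proof (rule norm_cycle_average_le)
    fix b assume b: "b \<in> cycles q r j"
    have "(\<Sum>k\<le>2. (\<i> * complex_of_real (s * Y b)) ^ k / fact k) = 1 + \<i> * of_real (s * Y b) - of_real ((s * Y b)\<^sup>2 / 2)"
      by (simp add: numeral_2_eq_2 power2_eq_square algebra_simps)
    then have "norm (iexp (s * Y b) - (1 + \<i> * of_real (s * Y b) - of_real ((s * Y b)\<^sup>2 / 2))) \<le> \<bar>s * Y b\<bar> ^ 3 / 6"
      using iexp_approx1[of "s * Y b" 2] by (simp add: fact_numeral numeral_3_eq_3[symmetric])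
    also have "\<bar>s * Y b\<bar> \<le> \<bar>s\<bar> * (L * real j)"
      unfolding abs_mult Y_def using cycle_reward_le[OF b] by (intro mult_left_mono) auto
    then have "\<bar>s * Y b\<bar> ^ 3 / 6 \<le> (\<bar>s\<bar> * (L * real j)) ^ 3 / 6"
      by (intro divide_right_mono power_mono) auto
    also have "\<dots> = \<bar>s\<bar> ^ 3 * (L ^ 3 / 6 * real j ^ 3)" by (simp add: power_mult_distrib)
    finally show "norm (iexp (s * Y b) - (1 + \<i> * of_real (s * Y b) - of_real ((s * Y b)\<^sup>2 / 2)))
      \<le> \<bar>s\<bar> ^ 3 * (L ^ 3 / 6 * real j ^ 3)" .
  qed
  ultimately show ?thesis by (simp only: mult.assoc)
qed

text \<open>A majorant of \<open>norm (e s j) / \<bar>s\<bar>\<close> that is uniform in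
  \<open>s\<close>.\<close>

definition \<eta> :: "nat \<Rightarrow> real" where
  "\<eta> j = (\<Sum>i=0..j. \<bar>fps_nth V i\<bar> * (L * (real (j - i) * p (j - i))))"

lemma e_le: "norm (e s j) \<le> \<bar>s\<bar> * \<eta> j"
proof -
  have "norm (e s j) \<le> (\<Sum>i=0..j. \<bar>fps_nth V i\<bar> * (\<bar>s\<bar> * (L * (real (j - i) * p (j - i)))))"
    unfolding e_def
    by (rule sum_norm_le, simp only: norm_mult norm_of_real) (intro mult_left_mono pc_diff_le, simp)
  then show ?thesis by (simp add: \<eta>_def sum_distrib_left mult_ac)
qed

lemma \<eta>_nonneg: "\<eta> j \<ge> 0"
  unfolding \<eta>_def using L_nonneg p_nonneg by (intro sum_nonneg) auto

lemma summable_abs_V: "summable (\<lambda>i. real i ^ m * \<bar>fps_nth V i\<bar>)"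
  by (rule summable_finite[of "{..r}"]) (auto simp: V_nth_0)

lemma summable_\<eta>: "summable \<eta>" "summable (\<lambda>j. real j * \<eta> j)"
proof -
  define a where "a i = \<bar>fps_nth V i\<bar>" for i
  define b where "b m j = L * (real j ^ Suc m * p j)" for m j
  have sb: "summable (\<lambda>j. norm (b m j))" for m
    using summable_mult[OF summable_p[of "Suc m"], of L] L_nonneg p_nonneg by (simp add: b_def)
  have sa: "summable (\<lambda>i. norm (real i ^ m * a i))" for m
    using summable_abs_V[of m] by (simp add: a_def)
  have \<eta>: "\<eta> j = (\<Sum>i\<le>j. a i * b 0 (j - i))" for j
    by (simp add: \<eta>_def a_def b_def atMost_atLeast0)
  then have "\<eta> = (\<lambda>j. \<Sum>i\<le>j. a i * b 0 (j - i))" by (rule ext)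
  then show "summable \<eta>"
    using summable_Cauchy_product[OF _ sb[of 0], of a] sa[of 0] by simp
  have "real j * \<eta> j = (\<Sum>i\<le>j. (real i ^ 1 * a i) * b 0 (j - i)) + (\<Sum>i\<le>j. a i * b 1 (j - i))" for j
    unfolding \<eta> sum_distrib_left sum.distrib[symmetric]
  proof (rule sum.cong[OF refl])
    fix i assume "i \<in> {..j}"
    then obtain m where m: "j = i + m" by (auto simp: le_iff_add)
    have "b 1 m = real m * b 0 m" by (simp add: b_def)
    then show "real j * (a i * b 0 (j - i)) = real i ^ 1 * a i * b 0 (j - i) + a i * b 1 (j - i)"
      by (simp add: m algebra_simps)
  qed
  then show "summable (\<lambda>j. real j * \<eta> j)"
    using summable_add[OF summable_Cauchy_product[OF sa[of 1] sb[of 0]] summable_Cauchy_product[OF _ sb[of 1], of a]] sa[of 0]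
    by simp
qed

text \<open>The sum of a convolution is the product of the sums: V(1) = q^(-r) times the sum of
  \<open>pc s j - p j\<close>. In the Taylor expansion of the latter the linear term vanishes by
  \<open>y1_sums\<close> and the quadratic one is - sigma^2 q^r s^2 / 2 by
  \<open>y2_sums\<close>.\<close>

lemma e_sums:
  "\<exists>C. C \<ge> 0 \<and> (\<forall>s. \<exists>\<epsilon>. e s sums \<epsilon> \<and>
    norm (\<epsilon> + of_real (var_const q r f * s\<^sup>2 / 2)) \<le> C * \<bar>s\<bar> ^ 3)"
proof -
  define X where "X = real q ^ r"
  have X: "X > 0" using q by (simp add: X_def)
  define A where "A = (\<Sum>j. L ^ 3 / 6 * (real j ^ 3 * p j))"
  have sA: "summable (\<lambda>j. L ^ 3 / 6 * (real j ^ 3 * p j))" by (intro summable_mult summable_p)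
  have AX: "A / X \<ge> 0"
    unfolding A_def using X sA L_nonneg p_nonneg by (intro divide_nonneg_nonneg suminf_nonneg) auto
  have "\<exists>\<epsilon>. e s sums \<epsilon> \<and> norm (\<epsilon> + of_real (var_const q r f * s\<^sup>2 / 2)) \<le> A / X * \<bar>s\<bar> ^ 3" for s
  proof -
    define g where "g j = pc s j - of_real (p j)" for j
    define m where "m j = \<i> * of_real (s * y 1 j) - complex_of_real (s\<^sup>2 / 2 * y 2 j)" for j
    have m: "m sums (\<i> * of_real (s * 0) - of_real (s\<^sup>2 / 2 * (var_const q r f * X)))"
      unfolding m_def X_def by (intro sums_diff sums_mult sums_of_real y1_sums y2_sums)
    have ng: "summable (\<lambda>j. norm (g j))"
    proof (rule summable_comparison_test')
      show "summable (\<lambda>j. \<bar>s\<bar> * (L * (real j ^ 1 * p j)))" by (intro summable_mult summable_p)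
      show "norm (norm (g j)) \<le> \<bar>s\<bar> * (L * (real j ^ 1 * p j))" for j
        using pc_diff_le[of s j] by (simp add: g_def)
    qed
    have nd: "norm (g j - m j) \<le> \<bar>s\<bar> ^ 3 * (L ^ 3 / 6 * (real j ^ 3 * p j))" for j
      unfolding g_def m_def by (rule pc_expansion)
    have sd: "summable (\<lambda>j. norm (g j - m j))"
      by (rule summable_comparison_test'[OF summable_mult[OF sA, of "\<bar>s\<bar> ^ 3"]]) (use nd in simp)
    define G where "G = suminf g"
    have G: "g sums G" unfolding G_def by (rule summable_sums[OF summable_norm_cancel[OF ng]])
    have "(\<lambda>j. g j - m j) sums (G - (\<i> * of_real (s * 0) - of_real (s\<^sup>2 / 2 * (var_const q r f * X))))"
      by (rule sums_diff[OF G m])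
    also have "G - (\<i> * of_real (s * 0) - of_real (s\<^sup>2 / 2 * (var_const q r f * X))) =
        G + of_real (s\<^sup>2 / 2 * (var_const q r f * X))"
      by (simp only: mult_zero_right of_real_0 diff_0 diff_minus_eq_add)
    finally have "(\<lambda>j. g j - m j) sums (G + of_real (s\<^sup>2 / 2 * (var_const q r f * X)))" .
    then have "norm (G + of_real (s\<^sup>2 / 2 * (var_const q r f * X))) = norm (\<Sum>j. g j - m j)"
      by (simp add: sums_iff)
    also have "\<dots> \<le> (\<Sum>j. norm (g j - m j))" by (rule summable_norm[OF sd])
    also have "\<dots> \<le> (\<Sum>j. \<bar>s\<bar> ^ 3 * (L ^ 3 / 6 * (real j ^ 3 * p j)))"
      by (intro suminf_le nd sd summable_mult sA)
    also have "\<dots> = \<bar>s\<bar> ^ 3 * A" unfolding A_def by (rule suminf_mult[OF sA])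
    finally have G_le: "norm (G + of_real (s\<^sup>2 / 2 * (var_const q r f * X))) \<le> \<bar>s\<bar> ^ 3 * A" .
    define VC where "VC j = complex_of_real (fps_nth V j)" for j
    have nV: "summable (\<lambda>j. norm (VC j))" using summable_abs_V[of 0] by (simp add: VC_def)
    have "VC sums (\<Sum>j\<in>{..r}. VC j)" by (rule sums_finite) (auto simp: VC_def V_nth_0)
    also have "(\<Sum>j\<in>{..r}. VC j) = of_real (1 / X)"
      unfolding VC_def of_real_sum[symmetric] sum_V by (simp add: u_def X_def)
    finally have sV: "suminf VC = of_real (1 / X)" by (simp add: sums_iff)
    have "(\<lambda>k. \<Sum>i\<le>k. VC i * g (k - i)) sums (suminf VC * suminf g)"
      by (rule Cauchy_product_sums[OF nV ng])
    moreover have "(\<lambda>k. \<Sum>i\<le>k. VC i * g (k - i)) = e s"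
      by (simp add: e_def VC_def g_def atMost_atLeast0 fun_eq_iff)
    ultimately have es: "e s sums (of_real (1 / X) * G)" by (simp add: sV G_def)
    have "of_real (1 / X) * G + of_real (var_const q r f * s\<^sup>2 / 2) =
      of_real (1 / X) * (G + of_real (s\<^sup>2 / 2 * (var_const q r f * X)))"
      using X by (simp add: distrib_left)
    moreover have "norm (of_real (1 / X) * Z) = 1 / X * norm Z" for Z :: complex
      using X by (simp add: norm_mult norm_divide)
    moreover have "1 / X * norm (G + of_real (s\<^sup>2 / 2 * (var_const q r f * X))) \<le> 1 / X * (\<bar>s\<bar> ^ 3 * A)"
      using G_le X by (intro mult_left_mono) auto
    ultimately have "norm (of_real (1 / X) * G + of_real (var_const q r f * s\<^sup>2 / 2)) \<le> 1 / X * (\<bar>s\<bar> ^ 3 * A)"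
      by (simp only:)
    moreover have "1 / X * (\<bar>s\<bar> ^ 3 * A) = A / X * \<bar>s\<bar> ^ 3" by simp
    ultimately show ?thesis
      using es by metis
  qed
  then show ?thesis using AX by (intro exI[of _ "A / X"] conjI allI)
qed

text \<open>An instance of \<open>delay_recursion_estimate\<close> with
  \<open>S = \<bar>s\<bar>\<close> and rho = exp(- sigma^2 s^2 / 2). The bound is arranged so that
  for s of order k^(-1/2) the quantity (k + r) s^2 stays bounded while every summand keeps a further
  positive power of \<open>\<bar>s\<bar>\<close>.\<close>

lemma cf_asymptotics:
  "\<exists>A C. A \<ge> 0 \<and> C \<ge> 0 \<and> (\<forall>s k. \<bar>s\<bar> * A \<le> 1 / 2 \<longrightarrow>
      norm (cf s (k + r) - of_real (exp (- (var_const q r f * s\<^sup>2 / 2)) ^ k) * cf s r) \<le>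
      \<bar>s\<bar> * A * (2 * (var_const q r f / 2 + C * \<bar>s\<bar>) * (real (k + r) * s\<^sup>2) + 4)
      + (C * \<bar>s\<bar> + (var_const q r f / 2)\<^sup>2 * s\<^sup>2) * (real (k + r) * s\<^sup>2))"
proof -
  obtain C where C: "C \<ge> 0" "\<forall>s. \<exists>\<epsilon>. e s sums \<epsilon> \<and>
      norm (\<epsilon> + of_real (var_const q r f * s\<^sup>2 / 2)) \<le> C * \<bar>s\<bar> ^ 3"
    using e_sums by (elim exE conjE) (rule that)
  define A where "A = (\<Sum>j. real j * \<eta> j)"
  have A: "A \<ge> 0" unfolding A_def using summable_\<eta>(2) \<eta>_nonneg by (intro suminf_nonneg) auto
  have "norm (cf s (k + r) - of_real (exp (- (var_const q r f * s\<^sup>2 / 2)) ^ k) * cf s r) \<le>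
      \<bar>s\<bar> * A * (2 * (var_const q r f / 2 + C * \<bar>s\<bar>) * (real (k + r) * s\<^sup>2) + 4)
      + (C * \<bar>s\<bar> + (var_const q r f / 2)\<^sup>2 * s\<^sup>2) * (real (k + r) * s\<^sup>2)"
    if small: "\<bar>s\<bar> * A \<le> 1 / 2" for s k
  proof -
    define c where "c = var_const q r f / 2"
    define v where "v = c * s\<^sup>2"
    have c0: "c \<ge> 0" using var_const_nonneg by (simp add: c_def)
    then have v0: "v \<ge> 0" by (simp add: v_def)
    have v: "var_const q r f * s\<^sup>2 / 2 = v" by (simp add: v_def c_def)
    obtain \<epsilon> where \<epsilon>: "e s sums \<epsilon>" "norm (\<epsilon> + of_real v) \<le> C * \<bar>s\<bar> ^ 3"
      using C(2)[rule_format, of s] unfolding v by (elim exE conjE) (rule that)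
    define \<rho> where "\<rho> = complex_of_real (exp (- v))"
    have main: "norm (cf s (k + r) - \<rho> ^ (k + r - r) * cf s r) \<le>
      \<bar>s\<bar> * A * (2 * norm \<epsilon> * real (k + r) + 4) + real (k + r) * norm (1 + \<epsilon> - \<rho>)"
      unfolding A_def
    proof (rule delay_recursion_estimate)
      show "\<bar>s\<bar> * (\<Sum>j. real j * \<eta> j) \<le> 1 / 2" using small by (simp add: A_def)
      show "norm \<rho> \<le> 1" using v0 by (simp add: \<rho>_def)
    qed (use cf_increment e_0 norm_cf_le e_le \<eta>_nonneg summable_\<eta> \<epsilon>(1) in auto)
    have s3: "\<bar>s\<bar> ^ 3 = \<bar>s\<bar> * s\<^sup>2" by (simp add: power3_eq_cube power2_eq_square)
    have "norm \<epsilon> \<le> norm (\<epsilon> + of_real v) + norm (complex_of_real v)"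
      using norm_triangle_ineq4[of "\<epsilon> + of_real v" "of_real v"] by simp
    also have "\<dots> \<le> C * \<bar>s\<bar> ^ 3 + v" using \<epsilon>(2) v0 by simp
    also have "\<dots> = (c + C * \<bar>s\<bar>) * s\<^sup>2" unfolding s3 v_def by (simp add: distrib_right)
    finally have e1: "norm \<epsilon> \<le> (c + C * \<bar>s\<bar>) * s\<^sup>2" .
    have "1 + \<epsilon> - \<rho> = (\<epsilon> + of_real v) + of_real (1 - v - exp (- v))" by (simp add: \<rho>_def)
    then have "norm (1 + \<epsilon> - \<rho>) \<le> norm (\<epsilon> + of_real v) + norm (complex_of_real (1 - v - exp (- v)))"
      by (metis norm_triangle_ineq)
    also have "\<dots> \<le> C * \<bar>s\<bar> ^ 3 + v\<^sup>2"
      unfolding norm_of_real using \<epsilon>(2) exp_minus_second_order[OF v0] by (rule add_mono)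
    also have "\<dots> = (C * \<bar>s\<bar> + c\<^sup>2 * s\<^sup>2) * s\<^sup>2"
      unfolding s3 v_def power_mult_distrib power2_eq_square[of "s\<^sup>2"] by (simp add: distrib_right)
    finally have e2: "norm (1 + \<epsilon> - \<rho>) \<le> (C * \<bar>s\<bar> + c\<^sup>2 * s\<^sup>2) * s\<^sup>2" .
    have "\<bar>s\<bar> * A * (2 * norm \<epsilon> * real (k + r) + 4) \<le>
        \<bar>s\<bar> * A * (2 * ((c + C * \<bar>s\<bar>) * s\<^sup>2) * real (k + r) + 4)"
      using A by (intro mult_left_mono add_right_mono mult_right_mono e1) auto
    moreover have "real (k + r) * norm (1 + \<epsilon> - \<rho>) \<le> real (k + r) * ((C * \<bar>s\<bar> + c\<^sup>2 * s\<^sup>2) * s\<^sup>2)"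
      by (intro mult_left_mono e2) auto
    ultimately have "norm (cf s (k + r) - \<rho> ^ (k + r - r) * cf s r) \<le>
      \<bar>s\<bar> * A * (2 * ((c + C * \<bar>s\<bar>) * s\<^sup>2) * real (k + r) + 4)
        + real (k + r) * ((C * \<bar>s\<bar> + c\<^sup>2 * s\<^sup>2) * s\<^sup>2)"
      using main by linarith
    moreover have "2 * ((c + C * \<bar>s\<bar>) * s\<^sup>2) * real (k + r) = 2 * (c + C * \<bar>s\<bar>) * (real (k + r) * s\<^sup>2)"
      "real (k + r) * ((C * \<bar>s\<bar> + c\<^sup>2 * s\<^sup>2) * s\<^sup>2) = (C * \<bar>s\<bar> + c\<^sup>2 * s\<^sup>2) * (real (k + r) * s\<^sup>2)"
      by (simp_all only: mult_ac)
    moreover have "\<rho> ^ (k + r - r) = of_real (exp (- v) ^ k)" by (simp add: \<rho>_def)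
    ultimately show ?thesis unfolding v c_def[symmetric] by (simp only:)
  qed
  then show ?thesis using A C(1) by (intro exI[of _ A] exI[of _ C] conjI allI impI)
qed

text \<open>The phase corrects the centring, which is at \<open>\<mu> * k\<close> here and at
  \<open>\<mu> * (k + r)\<close> in \<open>cf\<close>; the factor \<open>q ^ r\<close> undoes the
  weight of the \<open>r\<close> padding zeros.\<close>

lemma char_standardized:
  fixes \<sigma> :: real
  defines "s \<equiv> \<lambda>t k. t / (\<sigma> * sqrt (real k))"
  shows "char (distr (measure_pmf (unif_pmf q k)) borel (\<lambda>n. (h n - \<mu> * real k) / (\<sigma> * sqrt (real k)))) t =
    iexp (s t k * (\<mu> * real r)) * (of_nat q ^ r * cf (s t k) (k + r))"
proof -
  have "char (distr (measure_pmf (unif_pmf q k)) borel (\<lambda>n. (h n - \<mu> * real k) / (\<sigma> * sqrt (real k)))) t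
    = measure_pmf.expectation (unif_pmf q k) (\<lambda>n. iexp (t * ((h n - \<mu> * real k) / (\<sigma> * sqrt (real k)))))"
    unfolding char_def by (subst integral_distr) auto
  also have "\<dots> = measure_pmf.expectation (unif_pmf q k)
      (\<lambda>n. iexp (s t k * (\<mu> * real r)) * iexp (s t k * (h n - \<mu> * real (k + r))))"
  proof -
    have "iexp (t * ((h n - \<mu> * real k) / (\<sigma> * sqrt (real k)))) =
      iexp (s t k * (\<mu> * real r)) * iexp (s t k * (h n - \<mu> * real (k + r)))" for n
    proof -
      have "t * ((h n - \<mu> * real k) / (\<sigma> * sqrt (real k))) = s t k * (h n - \<mu> * real k)"
        by (simp add: s_def)
      also have "\<dots> = s t k * (\<mu> * real r) + s t k * (h n - \<mu> * real (k + r))"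
        by (simp add: algebra_simps)
      finally show ?thesis by (simp only: of_real_add distrib_left exp_add)
    qed
    then show ?thesis by (simp only:)
  qed
  also have "\<dots> = iexp (s t k * (\<mu> * real r)) *
      measure_pmf.expectation (unif_pmf q k) (\<lambda>n. iexp (s t k * (h n - \<mu> * real (k + r))))"
    by (rule integral_mult_right_zero)
  also have "\<dots> = iexp (s t k * (\<mu> * real r)) * (of_nat q ^ r * cf (s t k) (k + r))"
    unfolding cf_def by (subst R_expectation[symmetric]) simp
  finally show ?thesis .
qed

lemma weak_convergence:
  assumes "var_const q r f \<noteq> 0"
  shows "weak_conv_m
    (\<lambda>k. distr (measure_pmf (unif_pmf q k)) borel
      (\<lambda>n. (h n - \<mu> * real k) / (sqrt (var_const q r f) * sqrt (real k))))
    std_normal_distribution"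
proof (rule levy_continuity)
  show "real_distribution std_normal_distribution" by (rule real_dist_normal_dist)
  show "real_distribution (distr (measure_pmf (unif_pmf q k)) borel
      (\<lambda>n. (h n - \<mu> * real k) / (sqrt (var_const q r f) * sqrt (real k))))" for k
    by (rule prob_space.real_distribution_distr) (auto intro: measure_pmf.prob_space_axioms)
  fix t :: real
  define \<sigma> where "\<sigma> = sqrt (var_const q r f)"
  have var: "var_const q r f > 0" using assms var_const_nonneg by simp
  then have \<sigma>: "\<sigma> > 0" "\<sigma>\<^sup>2 = var_const q r f" by (auto simp: \<sigma>_def)
  define s where "s k = t / (\<sigma> * sqrt (real k))" for k
  define \<phi> where "\<phi> k = iexp (s k * (\<mu> * real r)) * (of_nat q ^ r * cf (s k) (k + r))" for k
  obtain A C where AC: "A \<ge> 0" "C \<ge> 0" and est: "\<forall>s k. \<bar>s\<bar> * A \<le> 1 / 2 \<longrightarrow>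
      norm (cf s (k + r) - of_real (exp (- (var_const q r f * s\<^sup>2 / 2)) ^ k) * cf s r) \<le>
      \<bar>s\<bar> * A * (2 * (var_const q r f / 2 + C * \<bar>s\<bar>) * (real (k + r) * s\<^sup>2) + 4)
      + (C * \<bar>s\<bar> + (var_const q r f / 2)\<^sup>2 * s\<^sup>2) * (real (k + r) * s\<^sup>2)"
    using cf_asymptotics by (elim exE conjE) (rule that)
  define b where "b k = \<bar>s k\<bar> * A * (2 * (var_const q r f / 2 + C * \<bar>s k\<bar>) * (real (k + r) * (s k)\<^sup>2) + 4)
      + (C * \<bar>s k\<bar> + (var_const q r f / 2)\<^sup>2 * (s k)\<^sup>2) * (real (k + r) * (s k)\<^sup>2)" for k
  have s2: "(s k)\<^sup>2 = t\<^sup>2 / \<sigma>\<^sup>2 / real k" for k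
    by (simp add: s_def power_divide power_mult_distrib)
  have "(\<lambda>k. \<bar>t\<bar> / \<sigma> * sqrt (1 / real k)) \<longlonglongrightarrow> \<bar>t\<bar> / \<sigma> * sqrt 0"
    by (intro tendsto_intros lim_1_over_n)
  also have "(\<lambda>k. \<bar>t\<bar> / \<sigma> * sqrt (1 / real k)) = (\<lambda>k. \<bar>s k\<bar>)"
    using \<sigma> by (auto simp: s_def real_sqrt_divide abs_mult)
  finally have s0: "(\<lambda>k. \<bar>s k\<bar>) \<longlonglongrightarrow> 0" by simp
  then have s0': "s \<longlonglongrightarrow> 0" by (rule tendsto_rabs_zero_cancel)
  have "(\<lambda>k. t\<^sup>2 / \<sigma>\<^sup>2 + t\<^sup>2 / \<sigma>\<^sup>2 * real r * (1 / real k)) \<longlonglongrightarrow> t\<^sup>2 / \<sigma>\<^sup>2 + t\<^sup>2 / \<sigma>\<^sup>2 * real r * 0"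
    by (intro tendsto_intros lim_1_over_n)
  moreover have "\<forall>\<^sub>F k in sequentially. t\<^sup>2 / \<sigma>\<^sup>2 + t\<^sup>2 / \<sigma>\<^sup>2 * real r * (1 / real k) = real (k + r) * (s k)\<^sup>2"
    using eventually_gt_at_top[of 0] by eventually_elim (simp add: s2 distrib_right add_divide_distrib)
  ultimately have ks: "(\<lambda>k. real (k + r) * (s k)\<^sup>2) \<longlonglongrightarrow> t\<^sup>2 / \<sigma>\<^sup>2"
    by (simp add: tendsto_cong)
  have "b \<longlonglongrightarrow> 0 * A * (2 * (var_const q r f / 2 + C * 0) * (t\<^sup>2 / \<sigma>\<^sup>2) + 4)
      + (C * 0 + (var_const q r f / 2)\<^sup>2 * 0\<^sup>2) * (t\<^sup>2 / \<sigma>\<^sup>2)"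
    unfolding b_def by (intro tendsto_intros s0 s0' ks)
  then have b0: "b \<longlonglongrightarrow> 0" by simp
  have "(\<lambda>k. \<phi> k - of_real (exp (- (t\<^sup>2) / 2))) \<longlonglongrightarrow> 0"
  proof (rule Lim_null_comparison)
    show "(\<lambda>k. real q ^ r * b k) \<longlonglongrightarrow> 0" using tendsto_mult_right_zero[OF b0] by simp
    have "(\<lambda>k. \<bar>s k\<bar> * A) \<longlonglongrightarrow> 0" using tendsto_mult_left_zero[OF s0] .
    then have "\<forall>\<^sub>F k in sequentially. \<bar>s k\<bar> * A < 1 / 2" by (rule order_tendstoD) simp
    then show "\<forall>\<^sub>F k in sequentially. norm (\<phi> k - of_real (exp (- (t\<^sup>2) / 2))) \<le> real q ^ r * b k"
      using eventually_gt_at_top[of 0]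
    proof eventually_elim
      case (elim k)
      have "exp (- (var_const q r f * (s k)\<^sup>2 / 2)) ^ k = exp (real k * - (var_const q r f * (s k)\<^sup>2 / 2))"
        by (rule exp_of_nat_mult[symmetric])
      also have "real k * - (var_const q r f * (s k)\<^sup>2 / 2) = - (t\<^sup>2) / 2"
        using elim var by (simp add: s2 \<sigma>(2))
      finally have pw: "exp (- (var_const q r f * (s k)\<^sup>2 / 2)) ^ k = exp (- (t\<^sup>2) / 2)" .
      \<comment> \<open>Only the zero word contributes at index \<open>r\<close>. Its value cancels
        both the phase and the factor \<open>q ^ r\<close>, so the limit is exactly the Gaussian
        characteristic function.\<close>
      have cfr: "cf (s k) r = iexp (- (s k * (\<mu> * real r))) / of_nat q ^ r"
        by (simp add: cf_def R_def)
      define a where "a = iexp (s k * (\<mu> * real r))"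
      have a: "norm a = 1" "a * iexp (- (s k * (\<mu> * real r))) = 1"
        by (simp_all add: a_def norm_exp_i_times exp_minus)
      have "a * (of_nat q ^ r * (of_real (exp (- (t\<^sup>2) / 2)) * cf (s k) r)) =
        (a * iexp (- (s k * (\<mu> * real r)))) * of_real (exp (- (t\<^sup>2) / 2))"
        unfolding cfr using q by (simp add: mult_ac)
      then have E: "of_real (exp (- (t\<^sup>2) / 2)) = a * (of_nat q ^ r * (of_real (exp (- (t\<^sup>2) / 2)) * cf (s k) r))"
        by (simp only: a mult_1_left)
      have "\<phi> k = a * (of_nat q ^ r * cf (s k) (k + r))" by (simp only: \<phi>_def a_def)
      then have "\<phi> k - of_real (exp (- (t\<^sup>2) / 2)) =
        a * (of_nat q ^ r * cf (s k) (k + r)) - a * (of_nat q ^ r * (of_real (exp (- (t\<^sup>2) / 2)) * cf (s k) r))"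
        using E by (simp only:)
      also have "\<dots> = a * (of_nat q ^ r * (cf (s k) (k + r) - of_real (exp (- (t\<^sup>2) / 2)) * cf (s k) r))"
        by (simp only: right_diff_distrib)
      finally have "\<phi> k - of_real (exp (- (t\<^sup>2) / 2)) =
        a * (of_nat q ^ r * (cf (s k) (k + r) - of_real (exp (- (t\<^sup>2) / 2)) * cf (s k) r))" .
      then have "norm (\<phi> k - of_real (exp (- (t\<^sup>2) / 2))) =
        real q ^ r * norm (cf (s k) (k + r) - of_real (exp (- (t\<^sup>2) / 2)) * cf (s k) r)"
        using a by (simp add: norm_mult norm_power)
      also have "\<dots> \<le> real q ^ r * b k"
        using est[rule_format, of "s k" k] elim unfolding pw b_def by (intro mult_left_mono) auto
      finally show ?case .
    qed
  qed
  then have "\<phi> \<longlonglongrightarrow> of_real (exp (- (t\<^sup>2) / 2))" by (rule LIM_zero_cancel)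
  then show "(\<lambda>k. char (distr (measure_pmf (unif_pmf q k)) borel
      (\<lambda>n. (h n - \<mu> * real k) / (sqrt (var_const q r f) * sqrt (real k)))) t)
    \<longlonglongrightarrow> char std_normal_distribution t"
    unfolding char_standardized char_std_normal_distribution \<phi>_def s_def \<sigma>_def .
qed

end

theorem mainTheorem3:
  fixes q r :: nat and f :: "nat \<Rightarrow> real"
  assumes "q \<ge> 2"
    and "quasimultiplicative q r f"
    and "\<And>n. f n > 0"
    and "poly_growth f"
  shows "(\<lambda>k. measure_pmf.expectation (unif_pmf q k) (\<lambda>n. ln (f n)) - mean_const q r f * real k)
           \<in> O(\<lambda>_. 1)
       \<and> (\<lambda>k. measure_pmf.variance (unif_pmf q k) (\<lambda>n. ln (f n)) - var_const q r f * real k)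
           \<in> O(\<lambda>_. 1)
       \<and> (f \<noteq> (\<lambda>_. 1) \<longrightarrow>
           var_const q r f \<noteq> 0 \<and>
           weak_conv_m
             (\<lambda>k. distr (measure_pmf (unif_pmf q k)) borel
               (\<lambda>n. (ln (f n) - mean_const q r f * real k) / (sqrt (var_const q r f) * sqrt (real k))))
             std_normal_distribution)"
proof -
  interpret positive_quasimultiplicative q r f
    using assms by unfold_locales
  have h: "h = (\<lambda>n. ln (f n))" by (simp add: h_def fun_eq_iff)
  show ?thesis
    using mean_asymptotics variance_asymptotics var_const_eq_0D weak_convergence
    unfolding h by blast
qed

end
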